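(* Let $0\le T_0<T_1\le+\infty$, let $\Gamma$ be a network with Hamiltonians $\{H_\gamma\}$ and flux limiter $x\mapsto c_x$ as described in the context. Let $u,v:\Gamma\times[T_0,T_1)\to\mathbb{R}$ be uniformly continuous functions such that $u$ is a subsolution and $v$ is a supersolution of (HJ$\Gamma$) in $(T_0,T_1)$, with $u(\cdot,T_0)\le v(\cdot,T_0)$ on $\Gamma$. Then $u\le v$ in $\Gamma\times[T_0,T_1)$.
   Context: Network. $\Gamma=\bigcup_{\gamma\in\mathcal{E}}\gamma([0,1])\subset\mathbb{R}^N$, where $\mathcal{E}$ is a finite collection of arcs, i.e. simple $C^1$ curves $\gamma:[0,1]\to\mathbb{R}^N$ with nonvanishing derivative. Together with each arc $\gamma$ one also considers its inverse arc $-\gamma(s)=\gamma(1-s)$ (so the collection of arcs is regarded as closed under inversion). It is assumed that $\gamma((0,1))\cap\gamma'([0,1])=\emptyset$ whenever $\gamma'\ne\gamma$, $\gamma'\neq-\gamma$. Vertices are the initial and terminal points of arcs; $\mathbf{V}$ is the set of vertices. The network is connected (any two vertices are linked by a finite concatenation of arcs) and has no loops ($\gamma(0)\ne\gamma(1)$ for every arc). For $x\in\mathbf{V}$, $\Gamma_x=\{\gamma : \gamma(1)=x\}$. Hamiltonians. For each arc $\gamma$ a function $H_\gamma:[0,1]\times\mathbb{R}\to\mathbb{R}$ is given, with $H_{-\gamma}(s,p)=H_\gamma(1-s,-p)$. Each $H_\gamma$ is continuous in $(s,p)$, convex in $p$, coercive in $p$ uniformly in $s$, and for every $M>0$ there is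 $C_M$ with $H_\gamma(s,p)-H_\gamma(s,q)\le C_M|p-q|$ for all $s\in[0,1]$, $p,q\in(-M,M)$. Set $c_\gamma=-\max_{s\in[0,1]}\min_{p\in\mathbb{R}}H_\gamma(s,p)$. A flux limiter is a function $x\mapsto c_x$ from $\mathbf{V}$ to $\mathbb{R}$ with $c_x\le\min_{\gamma\in\Gamma_x}c_\gamma$ for all $x$. Equation. For $v:\Gamma\times[T_0,T_1)\to\mathbb{R}$ put $(v\circ\gamma)(s,t)=v(\gamma(s),t)$; $'$ denotes the derivative in $s$ and subscript $t$ that in $t$. (HJ$_\gamma$) is $w_t+H_\gamma(s,w')=0$ in $(0,1)\times(T_0,T_1)$. A subtangent (resp. supertangent) to a function at a point is a $C^1$ function $\varphi$ such that (function $-\varphi$) has a local minimum (resp. maximum) at that point; it is constrained to a closed set $C$ if the point is a minimizer (resp. maximizer) only relative to a neighborhood of it intersected with $C$. A continuous $v:\Gamma\times[T_0,T_1)\to\mathbb{R}$ is a supersolution of (HJ$\Gamma$) in $(T_0,T_1)$ if (i) $v\circ\gamma$ is a viscosity supersolution of (HJ$_\gamma$) for every arc $\gamma$; (ii) for every $x\in\mathbf{V}$, $t_0\in(T_0,T_1)$: if some $C^1$ subtangent $\phi$ to $v(x,\cdot)$ at $t_0$ satisfies $\frac{d}{dt}\phi(t_0)<c_x$, then there is an arc $\gamma\in\Gamma_x$ such that all $C^1$ subtangents $\varphi$, constrained to $[0,1]\times\overline{(T_0,T_1)}$, to $v\circ\gamma$ at $(1,t_0)$ satisfy $\varphi_t(1,t_0)+H_\gamma(1,\varphi'(1,t_0))\ge0$.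 It is a subsolution of (HJ$\Gamma$) in $(T_0,T_1)$ if (i) $v\circ\gamma$ is a viscosity subsolution of (HJ$_\gamma$) for every arc $\gamma$; (ii) for every $x\in\mathbf{V}$, $t_0\in(T_0,T_1)$, all $C^1$ supertangents $\psi$ to $v(x,\cdot)$ at $t_0$ satisfy $\frac{d}{dt}\psi(t_0)\le c_x$. *)

theory Defs
  imports "HOL-Analysis.Analysis"
begin

text \<open>
  An arc is a total function \<open>real \<Rightarrow> 'a\<close> of which only the restriction to \<open>{0..1}\<close> matters.
  Derivatives at the endpoints are one-sided. The inverse arc is the library's
  \<open>reversepath \<gamma> = (\<lambda>s. \<gamma> (1 - s))\<close>.
\<close>

definition C1_regular :: "(real \<Rightarrow> 'a::euclidean_space) \<Rightarrow> bool" where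
  "C1_regular \<gamma> \<longleftrightarrow>
    (\<exists>D. continuous_on {0..1} D \<and>
         (\<forall>s\<in>{0..1}. (\<gamma> has_vector_derivative D s) (at s within {0..1}) \<and> D s \<noteq> 0))"

definition vertices :: "(real \<Rightarrow> 'a::euclidean_space) set \<Rightarrow> 'a set" where
  "vertices E = pathstart ` E \<union> pathfinish ` E"

definition arcs_to :: "(real \<Rightarrow> 'a::euclidean_space) set \<Rightarrow> 'a \<Rightarrow> (real \<Rightarrow> 'a) set" where
  "arcs_to E x = {\<gamma> \<in> E. pathfinish \<gamma> = x}"

definition network_set :: "(real \<Rightarrow> 'a::euclidean_space) set \<Rightarrow> 'a set" where
  "network_set E = (\<Union>\<gamma>\<in>E. path_image \<gamma>)"

text \<open>
  The last clause is connectedness: two vertices are joined by a finite chain of arcs, each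
  starting where the previous one ends. Distinct members of \<open>E\<close> cannot agree on \<open>{0..1}\<close>, by the
  disjointness clause, so the values of arcs outside \<open>{0..1}\<close> do not create spurious arcs.
\<close>

definition network :: "(real \<Rightarrow> 'a::euclidean_space) set \<Rightarrow> bool" where
  "network E \<longleftrightarrow>
    finite E \<and>
    (\<forall>\<gamma>\<in>E. simple_path \<gamma> \<and> C1_regular \<gamma> \<and> pathstart \<gamma> \<noteq> pathfinish \<gamma>) \<and>
    (\<forall>\<gamma>\<in>E. reversepath \<gamma> \<in> E) \<and>
    (\<forall>\<gamma>\<in>E. \<forall>\<gamma>'\<in>E. \<gamma>' \<noteq> \<gamma> \<and> \<gamma>' \<noteq> reversepath \<gamma> \<longrightarrow>
        \<gamma> ` {0<..<1} \<inter> path_image \<gamma>' = {}) \<and>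
    (\<forall>x\<in>vertices E. \<forall>y\<in>vertices E. (x, y) \<in> {(pathstart \<gamma>, pathfinish \<gamma>) |\<gamma>. \<gamma> \<in> E}\<^sup>*)"

definition hamiltonians ::
    "(real \<Rightarrow> 'a::euclidean_space) set \<Rightarrow> ((real \<Rightarrow> 'a) \<Rightarrow> real \<Rightarrow> real \<Rightarrow> real) \<Rightarrow> bool" where
  "hamiltonians E H \<longleftrightarrow>
    (\<forall>\<gamma>\<in>E.
      (\<forall>s\<in>{0..1}. \<forall>p. H (reversepath \<gamma>) s p = H \<gamma> (1 - s) (- p)) \<and>
      continuous_on ({0..1} \<times> UNIV) (\<lambda>(s, p). H \<gamma> s p) \<and>
      (\<forall>s\<in>{0..1}. convex_on UNIV (H \<gamma> s)) \<and>
      (\<forall>K. \<exists>R. \<forall>s\<in>{0..1}. \<forall>p. \<bar>p\<bar> \<ge> R \<longrightarrow> H \<gamma> s p \<ge> K) \<and>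
      (\<forall>M>0. \<exists>C. \<forall>s\<in>{0..1}. \<forall>p\<in>{-M<..<M}. \<forall>q\<in>{-M<..<M}.
          H \<gamma> s p - H \<gamma> s q \<le> C * \<bar>p - q\<bar>))"

text \<open>
  \<open>- max\<^sub>s min\<^sub>p H\<^sub>\<gamma>(s,p)\<close>. Under \<^const>\<open>hamiltonians\<close> both extrema are attained, by continuity
  and uniform coercivity, so the supremum and infimum are a maximum and a minimum.
\<close>

definition arc_const :: "(real \<Rightarrow> real \<Rightarrow> real) \<Rightarrow> real" where
  "arc_const h = - (SUP s\<in>{0..1}. INF p. h s p)"

text \<open>
  The minimum is over a finite set, nonempty for every vertex because a network is closed under
  inversion of arcs.
\<close>

definition flux_limiter ::
    "(real \<Rightarrow> 'a::euclidean_space) set \<Rightarrow> ((real \<Rightarrow> 'a) \<Rightarrow> real \<Rightarrow> real \<Rightarrow> real) \<Rightarrow> ('a \<Rightarrow> real) \<Rightarrow> bool"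
  where
  "flux_limiter E H c \<longleftrightarrow> (\<forall>x\<in>vertices E. c x \<le> (MIN \<gamma>\<in>arcs_to E x. arc_const (H \<gamma>)))"

text \<open>
  Test functions are continuously differentiable (Frechet) in some open neighbourhood, in the
  whole ambient space, of the contact point \<open>z\<close>. Since tangency is a local notion, asking for
  global regularity instead, or for regularity up to the boundary on \<open>C\<close> when \<open>C\<close> is a closed
  half-strip, would give the same conditions (cut off, respectively extend across the boundary).
\<close>

definition C1_near :: "('b::real_normed_vector \<Rightarrow> real) \<Rightarrow> 'b \<Rightarrow> bool" where
  "C1_near \<phi> z \<longleftrightarrow>
    (\<exists>U (D :: 'b \<Rightarrow> 'b \<Rightarrow>\<^sub>L real). open U \<and> z \<in> U \<and> continuous_on U D \<and>
       (\<forall>y\<in>U. (\<phi> has_derivative blinfun_apply (D y)) (at y)))"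

definition subtangent_on ::
    "'b::real_normed_vector set \<Rightarrow> ('b \<Rightarrow> real) \<Rightarrow> 'b \<Rightarrow> ('b \<Rightarrow> real) \<Rightarrow> bool" where
  "subtangent_on C f z \<phi> \<longleftrightarrow>
    C1_near \<phi> z \<and> (\<forall>\<^sub>F y in at z within C. f z - \<phi> z \<le> f y - \<phi> y)"

definition supertangent_on ::
    "'b::real_normed_vector set \<Rightarrow> ('b \<Rightarrow> real) \<Rightarrow> 'b \<Rightarrow> ('b \<Rightarrow> real) \<Rightarrow> bool" where
  "supertangent_on C f z \<phi> \<longleftrightarrow>
    C1_near \<phi> z \<and> (\<forall>\<^sub>F y in at z within C. f y - \<phi> y \<le> f z - \<phi> z)"

definition ds :: "(real \<times> real \<Rightarrow> real) \<Rightarrow> real \<Rightarrow> real \<Rightarrow> real" where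
  "ds \<phi> s t = deriv (\<lambda>\<sigma>. \<phi> (\<sigma>, t)) s"

definition dt :: "(real \<times> real \<Rightarrow> real) \<Rightarrow> real \<Rightarrow> real \<Rightarrow> real" where
  "dt \<phi> s t = deriv (\<lambda>\<tau>. \<phi> (s, \<tau>)) t"

definition open_times :: "real \<Rightarrow> ereal \<Rightarrow> real set" where
  "open_times T0 T1 = {t. T0 < t \<and> ereal t < T1}"

definition time_dom :: "real \<Rightarrow> ereal \<Rightarrow> real set" where
  "time_dom T0 T1 = {t. T0 \<le> t \<and> ereal t < T1}"

definition along :: "('a \<times> real \<Rightarrow> real) \<Rightarrow> (real \<Rightarrow> 'a) \<Rightarrow> real \<times> real \<Rightarrow> real" where
  "along v \<gamma> = (\<lambda>(s, t). v (\<gamma> s, t))"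

definition viscosity_supersol ::
    "(real \<Rightarrow> real \<Rightarrow> real) \<Rightarrow> real \<Rightarrow> ereal \<Rightarrow> (real \<times> real \<Rightarrow> real) \<Rightarrow> bool" where
  "viscosity_supersol h T0 T1 w \<longleftrightarrow>
    (\<forall>s\<in>{0<..<1}. \<forall>t\<in>open_times T0 T1. \<forall>\<phi>.
       subtangent_on ({0<..<1} \<times> open_times T0 T1) w (s, t) \<phi> \<longrightarrow>
       dt \<phi> s t + h s (ds \<phi> s t) \<ge> 0)"

definition viscosity_subsol ::
    "(real \<Rightarrow> real \<Rightarrow> real) \<Rightarrow> real \<Rightarrow> ereal \<Rightarrow> (real \<times> real \<Rightarrow> real) \<Rightarrow> bool" where
  "viscosity_subsol h T0 T1 w \<longleftrightarrow>
    (\<forall>s\<in>{0<..<1}. \<forall>t\<in>open_times T0 T1. \<forall>\<phi>.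
       supertangent_on ({0<..<1} \<times> open_times T0 T1) w (s, t) \<phi> \<longrightarrow>
       dt \<phi> s t + h s (ds \<phi> s t) \<le> 0)"

text \<open>
  In the vertex condition the constraint set contains times \<open>t \<ge> T1\<close> (if \<open>T1 < \<infinity>\<close>), where the
  value of \<open>v\<close> is meaningless; this is harmless because \<open>t0 < T1\<close> and the constraint only acts
  near \<open>t0\<close>.
\<close>

definition HJ_supersolution ::
    "(real \<Rightarrow> 'a::euclidean_space) set \<Rightarrow> ((real \<Rightarrow> 'a) \<Rightarrow> real \<Rightarrow> real \<Rightarrow> real) \<Rightarrow> ('a \<Rightarrow> real) \<Rightarrow>
     real \<Rightarrow> ereal \<Rightarrow> ('a \<times> real \<Rightarrow> real) \<Rightarrow> bool" where
  "HJ_supersolution E H c T0 T1 v \<longleftrightarrow>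
    continuous_on (network_set E \<times> time_dom T0 T1) v \<and>
    (\<forall>\<gamma>\<in>E. viscosity_supersol (H \<gamma>) T0 T1 (along v \<gamma>)) \<and>
    (\<forall>x\<in>vertices E. \<forall>t0\<in>open_times T0 T1.
       (\<exists>\<phi>. subtangent_on (open_times T0 T1) (\<lambda>t. v (x, t)) t0 \<phi> \<and> deriv \<phi> t0 < c x) \<longrightarrow>
       (\<exists>\<gamma>\<in>arcs_to E x. \<forall>\<phi>.
          subtangent_on ({0..1} \<times> closure (open_times T0 T1)) (along v \<gamma>) (1, t0) \<phi> \<longrightarrow>
          dt \<phi> 1 t0 + H \<gamma> 1 (ds \<phi> 1 t0) \<ge> 0))"

definition HJ_subsolution ::
    "(real \<Rightarrow> 'a::euclidean_space) set \<Rightarrow> ((real \<Rightarrow> 'a) \<Rightarrow> real \<Rightarrow> real \<Rightarrow> real) \<Rightarrow> ('a \<Rightarrow> real) \<Rightarrow>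
     real \<Rightarrow> ereal \<Rightarrow> ('a \<times> real \<Rightarrow> real) \<Rightarrow> bool" where
  "HJ_subsolution E H c T0 T1 u \<longleftrightarrow>
    continuous_on (network_set E \<times> time_dom T0 T1) u \<and>
    (\<forall>\<gamma>\<in>E. viscosity_subsol (H \<gamma>) T0 T1 (along u \<gamma>)) \<and>
    (\<forall>x\<in>vertices E. \<forall>t0\<in>open_times T0 T1. \<forall>\<psi>.
       supertangent_on (open_times T0 T1) (\<lambda>t. u (x, t)) t0 \<psi> \<longrightarrow> deriv \<psi> t0 \<le> c x)"

end

theory Submission
  imports Defs
begin

text \<open>
  Suppose \<open>u > v\<close> somewhere. Subtract a penalty \<open>G t = \<kappa> / (T' - t)\<close> from \<open>u\<close>, with \<open>T' < T1\<close>, so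
  that \<open>u - G\<close> becomes a strict subsolution, and maximize
  \<open>u (x, t) - G t - v (x, \<tau>) - C * (t - \<tau>)\<^sup>2\<close>, doubling the time variable only. For large \<open>C\<close> the
  maximum is attained at some \<open>(x, t, \<tau>)\<close> with interior times; put \<open>a = 2 * C * (t - \<tau>)\<close>.

  If \<open>x\<close> lies inside an arc, the arc parameter is doubled as well and the classical argument applies.

  If \<open>x\<close> is a vertex, the flux condition for \<open>u\<close> gives \<open>a \<le> c x - \<delta>\<close>, so the condition for \<open>v\<close> provides
  an arc \<open>\<gamma>\<close> ending at \<open>x\<close> on which \<open>v\<close> is a constrained supersolution at \<open>(1, \<tau>)\<close>, and there is
  \<open>p0\<close> with \<open>a + H \<gamma> 1 p0 < 0\<close>. Let \<open>p1 \<ge> p0\<close> be a slope still satisfying \<open>a + H \<gamma> 1 p1 < 0\<close> but beyond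
  which \<open>a + H \<gamma> 1\<close> stays above \<open>- \<delta>\<close>; it exists by convexity and coercivity. The strict subsolution cannot
  fall off faster than with slope \<open>p1\<close> when leaving the vertex, and maximality transfers this to the lower
  bound \<open>p1 * (s - 1)\<close> for \<open>v\<close>, up to terms in time. As \<open>a + H \<gamma> < 0\<close> on the slopes between \<open>p0\<close> and \<open>p1\<close>,
  the supersolution property in the interior of the arc improves the bound to \<open>p0 * (s - 1)\<close>. This is a
  constrained subtangent of slope \<open>p0\<close> at the vertex, a contradiction.
\<close>

section \<open>Continuously differentiable functions of one variable and separated test
  functions\<close>

text \<open>The domain is a parameter because the barriers and the penalty used later have poles and
  are smooth only on a half-line. Keeping the derivative as an explicit function lets
  \<open>ds\<close> and \<open>dt\<close> be evaluated without recomputing limits.\<close>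

definition C1_on :: "real set \<Rightarrow> (real \<Rightarrow> real) \<Rightarrow> (real \<Rightarrow> real) \<Rightarrow> bool" where
  "C1_on A f f' \<longleftrightarrow>
    open A \<and> continuous_on A f' \<and> (\<forall>x\<in>A. (f has_real_derivative f' x) (at x))"

lemma C1_onI:
  assumes "open A" "continuous_on A f'" "\<And>x. x \<in> A \<Longrightarrow> (f has_real_derivative f' x) (at x)"
  shows "C1_on A f f'"
  using assms by (auto simp: C1_on_def)

lemma C1_on_subset: "C1_on A f f' \<Longrightarrow> open B \<Longrightarrow> B \<subseteq> A \<Longrightarrow> C1_on B f f'"
  by (auto simp: C1_on_def intro: continuous_on_subset)

lemma C1_on_add: "C1_on A f f' \<Longrightarrow> C1_on A g g' \<Longrightarrow> C1_on A (\<lambda>x. f x + g x) (\<lambda>x. f' x + g' x)"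
  by (auto simp: C1_on_def intro!: continuous_intros derivative_eq_intros)

lemma C1_on_minus: "C1_on A f f' \<Longrightarrow> C1_on A (\<lambda>x. - f x) (\<lambda>x. - f' x)"
  by (auto simp: C1_on_def intro!: continuous_intros derivative_eq_intros)

lemma C1_on_continuous: "C1_on A f f' \<Longrightarrow> continuous_on A f"
  by (meson C1_on_def DERIV_isCont continuous_at_imp_continuous_on)

lemma C1_near_real:
  assumes "C1_on A f f'" "x \<in> A"
  shows "C1_near f x"
  unfolding C1_near_def
proof (intro exI conjI ballI)
  show "open A" "x \<in> A" using assms by (auto simp: C1_on_def)
  show "continuous_on A (\<lambda>x. f' x *\<^sub>R (id_blinfun :: real \<Rightarrow>\<^sub>L real))"
    using assms by (auto simp: C1_on_def intro!: continuous_intros)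
  fix y assume "y \<in> A"
  then have "(f has_real_derivative f' y) (at y)" using assms by (auto simp: C1_on_def)
  then show "(f has_derivative blinfun_apply (f' y *\<^sub>R id_blinfun)) (at y)"
    by (simp add: has_field_derivative_def scaleR_blinfun.rep_eq id_blinfun.rep_eq)
qed

text \<open>The derivative is a combination of the two fixed projections with coefficients
  \<open>f'\<close> and \<open>g'\<close>, so its continuity in operator norm reduces to that of the
  coefficients.\<close>

lemma C1_near_sep:
  assumes "C1_on A f f'" "C1_on B g g'" "s \<in> A" "t \<in> B"
  shows "C1_near (\<lambda>(s, t). f s + g t) (s, t)"
  unfolding C1_near_def
proof (intro exI conjI ballI)
  show "open (A \<times> B)" "(s, t) \<in> A \<times> B" using assms by (auto simp: C1_on_def intro: open_Times)
  have "continuous_on (A \<times> B) (\<lambda>z. f' (fst z))" "continuous_on (A \<times> B) (\<lambda>z. g' (snd z))"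
    using assms
    by (auto simp: C1_on_def intro!: continuous_on_compose2[of A f'] continuous_on_compose2[of B g']
        continuous_on_fst continuous_on_snd continuous_on_id)
  then show "continuous_on (A \<times> B) (\<lambda>z. f' (fst z) *\<^sub>R fst_blinfun + g' (snd z) *\<^sub>R snd_blinfun)"
    by (intro continuous_intros)
  fix y assume "y \<in> A \<times> B"
  then obtain x z where y: "y = (x, z)" "x \<in> A" "z \<in> B" by auto
  have "(f has_derivative (*) (f' x)) (at x)" "(g has_derivative (*) (g' z)) (at z)"
    using assms y by (auto simp: C1_on_def has_field_derivative_def)
  then have 1: "((\<lambda>w. f (fst w)) has_derivative (\<lambda>w. f' x * fst w)) (at y)"
       "((\<lambda>w. g (snd w)) has_derivative (\<lambda>w. g' z * snd w)) (at y)"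
    using has_derivative_compose[of fst fst y UNIV f] has_derivative_compose[of snd snd y UNIV g]
      has_derivative_fst[OF has_derivative_ident] has_derivative_snd[OF has_derivative_ident]
    by (auto simp: y)
  from has_derivative_add[OF 1]
  show "((\<lambda>(s, t). f s + g t) has_derivative
      blinfun_apply (f' (fst y) *\<^sub>R fst_blinfun + g' (snd y) *\<^sub>R snd_blinfun)) (at y)"
    by (simp add: case_prod_unfold y blinfun.add_left scaleR_blinfun.rep_eq plus_blinfun.rep_eq
        fst_blinfun.rep_eq snd_blinfun.rep_eq)
qed

lemma ds_sep: "C1_on A f f' \<Longrightarrow> s \<in> A \<Longrightarrow> ds (\<lambda>(s, t). f s + g t) s t = f' s"
  unfolding ds_def C1_on_def
  by (rule DERIV_imp_deriv) (auto intro!: derivative_eq_intros)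

lemma dt_sep: "C1_on B g g' \<Longrightarrow> t \<in> B \<Longrightarrow> dt (\<lambda>(s, t). f s + g t) s t = g' t"
  unfolding dt_def C1_on_def
  by (rule DERIV_imp_deriv) (auto intro!: derivative_eq_intros)

section \<open>Viscosity inequalities for separated test functions\<close>

text \<open>Every test function needed below has the form \<open>f s + g t\<close>, so the viscosity inequalities are
  only recorded for local extrema of \<open>w - f - g\<close> over open boxes.\<close>

definition sep_strict_subsol ::
    "(real \<Rightarrow> real \<Rightarrow> real) \<Rightarrow> real set \<Rightarrow> real set \<Rightarrow> real \<Rightarrow> (real \<times> real \<Rightarrow> real) \<Rightarrow> bool" where
  "sep_strict_subsol h S I \<delta> w \<longleftrightarrow>
    (\<forall>A B f f' g g' s t. A \<subseteq> S \<longrightarrow> B \<subseteq> I \<longrightarrow> C1_on A f f' \<longrightarrow> C1_on B g g' \<longrightarrow> s \<in> A \<longrightarrow> t \<in> B \<longrightarrow>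
       (\<forall>x\<in>A. \<forall>y\<in>B. w (x, y) - (f x + g y) \<le> w (s, t) - (f s + g t)) \<longrightarrow>
       g' t + h s (f' s) \<le> - \<delta>)"

text \<open>Reflection turns supersolutions into subsolutions: negating \<open>w\<close> negates
  slopes and reverses the inequality. Statements about supersolutions can then be deduced from those
  about subsolutions.\<close>

definition sep_supersol ::
    "(real \<Rightarrow> real \<Rightarrow> real) \<Rightarrow> real set \<Rightarrow> real set \<Rightarrow> (real \<times> real \<Rightarrow> real) \<Rightarrow> bool" where
  "sep_supersol h S I w \<longleftrightarrow> sep_strict_subsol (\<lambda>s p. - h s (- p)) S I 0 (\<lambda>z. - w z)"

lemma sep_strict_subsolD:
  assumes "sep_strict_subsol h S I \<delta> w" "A \<subseteq> S" "B \<subseteq> I" "C1_on A f f'" "C1_on B g g'" "s \<in> A" "t \<in> B"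
    and "\<And>x y. x \<in> A \<Longrightarrow> y \<in> B \<Longrightarrow> w (x, y) - (f x + g y) \<le> w (s, t) - (f s + g t)"
  shows "g' t + h s (f' s) \<le> - \<delta>"
  using assms unfolding sep_strict_subsol_def by blast

lemma sep_supersolD:
  assumes "sep_supersol h S I w" "A \<subseteq> S" "B \<subseteq> I" "C1_on A f f'" "C1_on B g g'" "s \<in> A" "t \<in> B"
    and le: "\<And>x y. x \<in> A \<Longrightarrow> y \<in> B \<Longrightarrow> w (s, t) - (f s + g t) \<le> w (x, y) - (f x + g y)"
  shows "0 \<le> g' t + h s (f' s)"
proof -
  have "- g' t + - h s (- (- f' s)) \<le> - 0"
  proof (rule sep_strict_subsolD[OF assms(1)[unfolded sep_supersol_def] assms(2,3) C1_on_minus[OF assms(4)]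
        C1_on_minus[OF assms(5)] assms(6,7)])
    fix x y assume "x \<in> A" "y \<in> B"
    from le[OF this] show "- w (x, y) - (- f x + - g y) \<le> - w (s, t) - (- f s + - g t)" by simp
  qed
  then show ?thesis by simp
qed

lemma sep_strict_subsol_subset:
  "sep_strict_subsol h S I \<delta> w \<Longrightarrow> S' \<subseteq> S \<Longrightarrow> I' \<subseteq> I \<Longrightarrow> sep_strict_subsol h S' I' \<delta> w"
  unfolding sep_strict_subsol_def by (meson subset_trans)

lemma sep_supersol_subset: "sep_supersol h S I w \<Longrightarrow> S' \<subseteq> S \<Longrightarrow> I' \<subseteq> I \<Longrightarrow> sep_supersol h S' I' w"
  unfolding sep_supersol_def by (rule sep_strict_subsol_subset)

lemma eventually_box:
  assumes "open A" "open B" "s \<in> A" "t \<in> B" "\<And>x y. x \<in> A \<Longrightarrow> y \<in> B \<Longrightarrow> (x, y) \<in> C \<Longrightarrow> P (x, y)"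
  shows "\<forall>\<^sub>F z in at (s, t) within C. P z"
  unfolding eventually_at_topological
  using assms by (intro exI[of _ "A \<times> B"]) (auto intro: open_Times)

lemma viscosity_subsol_imp_sep:
  assumes "viscosity_subsol h T0 T1 w"
  shows "sep_strict_subsol h {0<..<1} (open_times T0 T1) 0 w"
  unfolding sep_strict_subsol_def
proof (intro allI impI)
  fix A B f f' g g' s t
  assume *: "A \<subseteq> {0<..<1}" "B \<subseteq> open_times T0 T1" "C1_on A f f'" "C1_on B g g'" "s \<in> A" "t \<in> B"
    and le: "\<forall>x\<in>A. \<forall>y\<in>B. w (x, y) - (f x + g y) \<le> w (s, t) - (f s + g t)"
  have "supertangent_on ({0<..<1} \<times> open_times T0 T1) w (s, t) (\<lambda>(s, t). f s + g t)"
    unfolding supertangent_on_def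
    using * le by (intro conjI C1_near_sep eventually_box[of A B]) (auto simp: C1_on_def)
  with assms * have "dt (\<lambda>(s, t). f s + g t) s t + h s (ds (\<lambda>(s, t). f s + g t) s t) \<le> 0"
    unfolding viscosity_subsol_def by blast
  then show "g' t + h s (f' s) \<le> - 0"
    using * by (simp add: ds_sep[OF *(3)] dt_sep[OF *(4)])
qed

lemma viscosity_supersol_imp_sep:
  assumes "viscosity_supersol h T0 T1 w"
  shows "sep_supersol h {0<..<1} (open_times T0 T1) w"
  unfolding sep_supersol_def sep_strict_subsol_def
proof (intro allI impI)
  fix A B f f' g g' s t
  assume *: "A \<subseteq> {0<..<1}" "B \<subseteq> open_times T0 T1" "C1_on A f f'" "C1_on B g g'" "s \<in> A" "t \<in> B"
    and le: "\<forall>x\<in>A. \<forall>y\<in>B. - w (x, y) - (f x + g y) \<le> - w (s, t) - (f s + g t)"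
  have "subtangent_on ({0<..<1} \<times> open_times T0 T1) w (s, t) (\<lambda>(s, t). - f s + - g t)"
    unfolding subtangent_on_def
  proof (intro conjI C1_near_sep[OF C1_on_minus[OF *(3)] C1_on_minus[OF *(4)] *(5,6)]
      eventually_box[of A B])
    show "open A" "open B" "s \<in> A" "t \<in> B" using * by (auto simp: C1_on_def)
    fix x y assume "x \<in> A" "y \<in> B"
    with le have "- w (x, y) - (f x + g y) \<le> - w (s, t) - (f s + g t)" by blast
    then show "w (s, t) - (case (s, t) of (s, t) \<Rightarrow> - f s + - g t)
        \<le> w (x, y) - (case (x, y) of (s, t) \<Rightarrow> - f s + - g t)" by simp
  qed
  with assms * have "dt (\<lambda>(s, t). - f s + - g t) s t + h s (ds (\<lambda>(s, t). - f s + - g t) s t) \<ge> 0"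
    unfolding viscosity_supersol_def by blast
  then show "g' t + - h s (- f' s) \<le> - 0"
    using * by (simp add: ds_sep[OF C1_on_minus[OF *(3)], of _ "\<lambda>x. - g x", simplified]
        dt_sep[OF C1_on_minus[OF *(4)], of _ "\<lambda>x. - f x", simplified])
qed

text \<open>Touching \<open>w - G\<close> by \<open>f + g\<close> is touching \<open>w\<close> by
  \<open>f + (g + G)\<close>, so the growth of \<open>G\<close> is what makes the inequality
  strict.\<close>

lemma sep_strict_subsol_minus_time:
  assumes "sep_strict_subsol h S I 0 w" "C1_on J G G'" "I' \<subseteq> I" "I' \<subseteq> J" "\<And>t. t \<in> I' \<Longrightarrow> \<delta> \<le> G' t"
  shows "sep_strict_subsol h S I' \<delta> (\<lambda>(s, t). w (s, t) - G t)"
  unfolding sep_strict_subsol_def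
proof (intro allI impI)
  fix A B f f' g g' s t
  assume *: "A \<subseteq> S" "B \<subseteq> I'" "C1_on A f f'" "C1_on B g g'" "s \<in> A" "t \<in> B"
    and le: "\<forall>x\<in>A. \<forall>y\<in>B. (case (x, y) of (s, t) \<Rightarrow> w (s, t) - G t) - (f x + g y)
      \<le> (case (s, t) of (s, t) \<Rightarrow> w (s, t) - G t) - (f s + g t)"
  have "C1_on B (\<lambda>t. g t + G t) (\<lambda>t. g' t + G' t)"
    using * assms(2,4) C1_on_subset[of J G G' B] by (intro C1_on_add) (auto simp: C1_on_def)
  then have "g' t + G' t + h s (f' s) \<le> - 0"
    using assms(3) * le by (intro sep_strict_subsolD[OF assms(1), of A B f f' "\<lambda>t. g t + G t" "\<lambda>t. g' t + G' t"])
      (auto simp: algebra_simps)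
  moreover have "\<delta> \<le> G' t" using assms * by auto
  ultimately show "g' t + h s (f' s) \<le> - \<delta>" by simp
qed

text \<open>The point \<open>(s0, t0)\<close> need not be a maximizer. It beats every boundary
  value, so the maximum over the compact box is attained inside, where the test inequality is
  available.\<close>

lemma sep_strict_subsol_box:
  assumes sub: "sep_strict_subsol h S I \<delta> w" and SI: "{x1<..<x2} \<subseteq> S" "{t1<..<t2} \<subseteq> I"
    and cont: "continuous_on ({x1..x2} \<times> {t1..t2}) w"
    and f: "C1_on A f f'" "{x1..x2} \<subseteq> A" and g: "C1_on B g g'" "{t1..t2} \<subseteq> B"
    and st0: "s0 \<in> {x1..x2}" "t0 \<in> {t1..t2}"
    and bd: "\<And>x t. x \<in> {x1..x2} \<Longrightarrow> t \<in> {t1..t2} \<Longrightarrow> x = x1 \<or> x = x2 \<or> t = t1 \<or> t = t2 \<Longrightarrow>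
      w (x, t) - (f x + g t) < w (s0, t0) - (f s0 + g t0)"
  obtains s t where "s \<in> {x1<..<x2}" "t \<in> {t1<..<t2}" "g' t + h s (f' s) \<le> - \<delta>"
proof -
  let ?K = "{x1..x2} \<times> {t1..t2}"
  let ?F = "\<lambda>z. w z - (f (fst z) + g (snd z))"
  have "continuous_on ?K (\<lambda>z. f (fst z))"
    by (rule continuous_on_compose2[OF C1_on_continuous[OF f(1)] continuous_on_fst[OF continuous_on_id]])
      (use f(2) in auto)
  moreover have "continuous_on ?K (\<lambda>z. g (snd z))"
    by (rule continuous_on_compose2[OF C1_on_continuous[OF g(1)] continuous_on_snd[OF continuous_on_id]])
      (use g(2) in auto)
  ultimately have "continuous_on ?K ?F" by (intro continuous_intros cont)
  moreover have "compact ?K" "?K \<noteq> {}" using st0 by (auto intro: compact_Times)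
  ultimately obtain z where z: "z \<in> ?K" "\<And>y. y \<in> ?K \<Longrightarrow> ?F y \<le> ?F z"
    using continuous_attains_sup[of ?K ?F] by blast
  obtain s t where st: "z = (s, t)" by force
  have "?F (s0, t0) \<le> ?F (s, t)" using z st st0 by blast
  with bd[of s t] z(1) st have "s \<noteq> x1" "s \<noteq> x2" "t \<noteq> t1" "t \<noteq> t2" by (force)+
  with z(1) st have in': "s \<in> {x1<..<x2}" "t \<in> {t1<..<t2}" by auto
  moreover have "g' t + h s (f' s) \<le> - \<delta>"
  proof (rule sep_strict_subsolD[OF sub SI _ _ in'])
    show "C1_on {x1<..<x2} f f'" by (rule C1_on_subset[OF f(1)]) (use f(2) in auto)
    show "C1_on {t1<..<t2} g g'" by (rule C1_on_subset[OF g(1)]) (use g(2) in auto)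
    show "w (x, y) - (f x + g y) \<le> w (s, t) - (f s + g t)"
      if "x \<in> {x1<..<x2}" "y \<in> {t1<..<t2}" for x y
      using z(2)[of "(x, y)"] that st by auto
  qed
  ultimately show ?thesis using that by blast
qed

lemma sep_supersol_box:
  assumes sup: "sep_supersol h S I w" and SI: "{x1<..<x2} \<subseteq> S" "{t1<..<t2} \<subseteq> I"
    and cont: "continuous_on ({x1..x2} \<times> {t1..t2}) w"
    and f: "C1_on A f f'" "{x1..x2} \<subseteq> A" and g: "C1_on B g g'" "{t1..t2} \<subseteq> B"
    and st0: "s0 \<in> {x1..x2}" "t0 \<in> {t1..t2}"
    and bd: "\<And>x t. x \<in> {x1..x2} \<Longrightarrow> t \<in> {t1..t2} \<Longrightarrow> x = x1 \<or> x = x2 \<or> t = t1 \<or> t = t2 \<Longrightarrow>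
      w (s0, t0) - (f s0 + g t0) < w (x, t) - (f x + g t)"
  obtains s t where "s \<in> {x1<..<x2}" "t \<in> {t1<..<t2}" "0 \<le> g' t + h s (f' s)"
proof -
  have c: "continuous_on ({x1..x2} \<times> {t1..t2}) (\<lambda>z. - w z)" by (intro continuous_intros cont)
  obtain s t where "s \<in> {x1<..<x2}" "t \<in> {t1<..<t2}" "- g' t + - h s (- (- f' s)) \<le> - 0"
  proof (rule sep_strict_subsol_box[OF sup[unfolded sep_supersol_def] SI c C1_on_minus[OF f(1)] f(2)
        C1_on_minus[OF g(1)] g(2) st0])
    fix x t assume "x \<in> {x1..x2}" "t \<in> {t1..t2}" "x = x1 \<or> x = x2 \<or> t = t1 \<or> t = t2"
    from bd[OF this]
    show "- w (x, t) - (- f x + - g t) < - w (s0, t0) - (- f s0 + - g t0)" by simp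
  qed
  then show ?thesis using that by simp
qed

section \<open>Quadratic and barrier test functions\<close>

text \<open>One family covers all quadratic and affine test functions below, which is why they carry
  summands with coefficient 0.\<close>

lemma C1_on_quadratic:
  "C1_on UNIV (\<lambda>t. A * (t - t1)^2 + B * (t - t2)^2 + D * t)
    (\<lambda>t. 2 * A * (t - t1) + 2 * B * (t - t2) + D)"
  by (rule C1_onI) (auto intro!: derivative_eq_intros continuous_intros simp: algebra_simps)

lemma C1_on_barrier_in:
  "C1_on {..<1} (\<lambda>s. p * (s - 1) + \<sigma> / (1 - s)) (\<lambda>s. p + \<sigma> / (1 - s)^2)"
proof (rule C1_onI)
  show "continuous_on {..<1} (\<lambda>s. p + \<sigma> / (1 - s)^2)" by (auto intro!: continuous_intros)
qed (auto intro!: derivative_eq_intros simp: power2_eq_square)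

text \<open>For \<open>D > 0\<close> and \<open>s \<le> 1\<close> the added fraction vanishes at the
  vertex and stays below \<open>D * \<sigma>\<close>, while the slope rises from
  \<open>q - D\<close> at \<open>s = 1\<close> towards \<open>q\<close> farther away. A slope change
  of size \<open>D\<close> thus costs arbitrarily little in value. The pole
  \<open>1 + \<sigma>\<close> lies beyond the arc.\<close>

lemma C1_on_barrier_out:
  assumes "0 < \<sigma>"
  shows "C1_on {..<1 + \<sigma>} (\<lambda>s. q * (s - 1) + D * \<sigma> * (1 - s) / (\<sigma> + (1 - s)))
    (\<lambda>s. q - D * \<sigma>^2 / (\<sigma> + (1 - s))^2)"
proof (rule C1_onI)
  show "continuous_on {..<1 + \<sigma>} (\<lambda>s. q - D * \<sigma>^2 / (\<sigma> + (1 - s))^2)"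
    by (auto intro!: continuous_intros)
next
  fix s assume "s \<in> {..<1 + \<sigma>}"
  then have nz: "\<sigma> + (1 - s) \<noteq> 0" by auto
  have "((\<lambda>s. q * (s - 1) + D * \<sigma> * (1 - s) / (\<sigma> + (1 - s))) has_real_derivative
      q + (- (D * \<sigma>) * (\<sigma> + (1 - s)) - D * \<sigma> * (1 - s) * (- 1))
        / ((\<sigma> + (1 - s)) * (\<sigma> + (1 - s)))) (at s)"
    using nz by (auto intro!: derivative_eq_intros)
  also have "- (D * \<sigma>) * (\<sigma> + (1 - s)) - D * \<sigma> * (1 - s) * (- 1) = - (D * \<sigma>^2)"
    by (simp add: algebra_simps power2_eq_square)
  finally show "((\<lambda>s. q * (s - 1) + D * \<sigma> * (1 - s) / (\<sigma> + (1 - s))) has_real_derivative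
      q - D * \<sigma>^2 / (\<sigma> + (1 - s))^2) (at s)"
    by (simp add: power2_eq_square)
qed auto

section \<open>Slope bounds at the end of an arc\<close>

text \<open>The slopes of the test function run from \<open>p\<close> at \<open>s = 1\<close> up to \<open>p1 + e\<close>, staying within the
  interval where the Hamiltonian is too small for a supersolution.\<close>

lemma slope_improve:
  assumes sup: "sep_supersol h {1 - r<..<1} {tb - \<eta><..<tb + \<eta>} w"
    and pos: "0 < r" "0 < \<eta>" "0 < C" "0 < e" "p \<le> p1"
    and cont: "continuous_on ({1 - r..1} \<times> {tb - \<eta>..tb + \<eta>}) w"
    and h: "\<And>s q. s \<in> {1 - r<..<1} \<Longrightarrow> q \<in> {p - e..p1 + e} \<Longrightarrow> a + h s q < - \<kappa>"
    and \<kappa>: "4 * C * \<eta> \<le> \<kappa>"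
    and low: "\<And>s t. s \<in> {1 - r..1} \<Longrightarrow> t \<in> {tb - \<eta>..tb + \<eta>} \<Longrightarrow>
      w0 + a * (t - tb) - C * (t - tb)^2 + p1 * (s - 1) \<le> w (s, t)"
  shows "\<exists>\<rho>>0. \<rho> \<le> r \<and> (\<forall>s\<in>{1 - \<rho>..1}. \<forall>t\<in>{tb - \<eta>..tb + \<eta>}.
      w0 + a * (t - tb) - 2 * C * (t - tb)^2 + p * (s - 1) \<le> w (s, t))"
proof -
  \<comment> \<open>With this \<open>D\<close> the test function has slope exactly
    \<open>p - e\<close> at the vertex and less than \<open>p1 + e\<close> elsewhere, the range on
    which \<open>h\<close> is controlled.\<close>
  define D where "D = p1 + e - (p - e)"
  have D: "D > 0" using pos by (simp add: D_def)
  \<comment> \<open>The barrier adds at most \<open>D * \<sigma>\<close>. This must stay below the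
    margin \<open>e * r\<close> at the far side \<open>s = 1 - r\<close> and the margin
    \<open>C * \<eta>^2\<close> at the time ends; half of the smaller one is taken.\<close>
  define \<sigma> where "\<sigma> = min (e * r) (C * \<eta>^2) / (2 * D)"
  have \<sigma>: "\<sigma> > 0" "D * \<sigma> < e * r" "D * \<sigma> < C * \<eta>^2"
  proof -
    have m: "min (e * r) (C * \<eta>^2) > 0" using pos by simp
    then show "\<sigma> > 0" using D by (simp add: \<sigma>_def)
    have "D * \<sigma> = min (e * r) (C * \<eta>^2) / 2" using D by (simp add: \<sigma>_def)
    then show "D * \<sigma> < e * r" "D * \<sigma> < C * \<eta>^2" using m by linarith+
  qed
  define f where "f = (\<lambda>s. (p1 + e) * (s - 1) + D * \<sigma> * (1 - s) / (\<sigma> + (1 - s)))"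
  define f' where "f' = (\<lambda>s. (p1 + e) - D * \<sigma>^2 / (\<sigma> + (1 - s))^2)"
  \<comment> \<open>Compared with \<open>low\<close>, the quadratic coefficient is doubled; the
    surplus \<open>C * (t - tb)^2\<close> is the margin at the time ends.\<close>
  define g where "g = (\<lambda>t. (- 2 * C) * (t - tb)^2 + 0 * (t - tb)^2 + a * t)"
  define g' where "g' = (\<lambda>t. 2 * (- 2 * C) * (t - tb) + 2 * 0 * (t - tb) + a)"
  have f: "C1_on {..<1 + \<sigma>} f f'" unfolding f_def f'_def by (rule C1_on_barrier_out[OF \<sigma>(1)])
  have g: "C1_on UNIV g g'" unfolding g_def g'_def by (rule C1_on_quadratic)
  have frac: "0 \<le> (1 - s) / (\<sigma> + (1 - s))" "(1 - s) / (\<sigma> + (1 - s)) \<le> 1" if "s \<le> 1" for s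
    using that \<sigma> by (auto simp: divide_simps)
  have Dfrac: "D * \<sigma> * (1 - s) / (\<sigma> + (1 - s)) \<le> D * \<sigma>" if "s \<le> 1" for s
    using mult_left_mono[OF frac(2)[OF that], of "D * \<sigma>"] D \<sigma> by simp
  \<comment> \<open>A smaller value would lie strictly below all values on the boundary of the box,
    so the minimum would be interior. There \<open>g'\<close> is at most \<open>a + \<kappa>\<close>
    and the slope of \<open>f\<close> lies where \<open>a + h < - \<kappa>\<close>, against the
    supersolution property.\<close>
  have main: "w0 - a * tb \<le> w (s, t) - (f s + g t)"
    if st: "s \<in> {1 - r..1}" "t \<in> {tb - \<eta>..tb + \<eta>}" for s t
  proof (rule ccontr)
    assume neg: "\<not> ?thesis"
    have *: "w0 - a * tb + C * (t - tb)^2 + e * (1 - s) - D * \<sigma> * (1 - s) / (\<sigma> + (1 - s))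
        \<le> w (s, t) - (f s + g t)"
      if "s \<in> {1 - r..1}" "t \<in> {tb - \<eta>..tb + \<eta>}" for s t
      using low[OF that] by (simp add: f_def g_def algebra_simps)
    have sub: "{1 - r<..<1} \<subseteq> {1 - r<..<1}" "{tb - \<eta><..<tb + \<eta>} \<subseteq> {tb - \<eta><..<tb + \<eta>}" by auto
    have sub2: "{1 - r..1} \<subseteq> {..<1 + \<sigma>}" "{tb - \<eta>..tb + \<eta>} \<subseteq> UNIV" using \<sigma> by auto
    obtain s' t' where s't': "s' \<in> {1 - r<..<1}" "t' \<in> {tb - \<eta><..<tb + \<eta>}"
      and ge: "0 \<le> g' t' + h s' (f' s')"
    proof (rule sep_supersol_box[OF sup sub cont f sub2(1) g sub2(2) st])
      fix x y assume xy: "x \<in> {1 - r..1}" "y \<in> {tb - \<eta>..tb + \<eta>}"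
        and "x = 1 - r \<or> x = 1 \<or> y = tb - \<eta> \<or> y = tb + \<eta>"
      then consider "x = 1 - r" | "x = 1" | "(y - tb)^2 = \<eta>^2" by fastforce
      then have "w0 - a * tb \<le> w (x, y) - (f x + g y)"
      proof cases
        case 1
        have "e * (1 - x) = e * r" using 1 by simp
        moreover have "0 \<le> C * (y - tb)^2" using pos by simp
        ultimately show ?thesis using *[OF xy] Dfrac[of x] \<sigma> xy by auto
      next
        case 2
        have "0 \<le> C * (y - tb)^2" using pos by simp
        then show ?thesis using *[OF xy] 2 by auto
      next
        case 3
        have "0 \<le> e * (1 - x)" using pos xy by simp
        then show ?thesis using *[OF xy] Dfrac[of x] \<sigma> xy 3 by auto
      qed
      then show "w (s, t) - (f s + g t) < w (x, y) - (f x + g y)" using neg by linarith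
    qed
    have "0 \<le> \<sigma>^2 / (\<sigma> + (1 - s'))^2" "\<sigma>^2 / (\<sigma> + (1 - s'))^2 \<le> 1"
      using s't' \<sigma> by (auto simp: divide_simps intro!: power_mono)
    from mult_left_mono[OF this(1), of D] mult_left_mono[OF this(2), of D]
    have "f' s' \<in> {p - e..p1 + e}" using D by (auto simp: f'_def D_def)
    from h[OF s't'(1) this] have "a + h s' (f' s') < - \<kappa>" .
    moreover have "C * (tb - t') \<le> C * \<eta>" using s't' pos by (intro mult_left_mono) auto
    then have "g' t' \<le> a + \<kappa>" using \<kappa> by (simp add: g'_def algebra_simps)
    ultimately show False using ge by linarith
  qed
  \<comment> \<open>At distance \<open>y \<le> e * \<sigma> / D\<close> from the vertex the barrier
    is still at least \<open>(D - e) * y\<close>. Since \<open>D - e = p1 + e - p\<close>, this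
    lifts the line of slope \<open>p1 + e\<close> at least to the line of slope
    \<open>p\<close>.\<close>
  define \<rho> where "\<rho> = min r (e * \<sigma> / D)"
  have "\<rho> > 0" "\<rho> \<le> r" using pos D \<sigma> by (auto simp: \<rho>_def)
  moreover have "w0 + a * (t - tb) - 2 * C * (t - tb)^2 + p * (s - 1) \<le> w (s, t)"
    if st: "s \<in> {1 - \<rho>..1}" "t \<in> {tb - \<eta>..tb + \<eta>}" for s t
  proof -
    define y where "y = 1 - s"
    have y: "0 \<le> y" "y \<le> \<rho>" using st by (auto simp: y_def)
    then have "y * D \<le> e * \<sigma>" using D by (auto simp: \<rho>_def pos_le_divide_eq)
    also have "\<dots> \<le> e * (\<sigma> + y)" using y pos by simp
    finally have "y * D / (\<sigma> + y) \<le> e" using y \<sigma> by (simp add: divide_simps)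
    from mult_left_mono[OF this y(1)]
    have "D * y * y / (\<sigma> + y) \<le> e * y" by (simp add: algebra_simps)
    moreover have "D * \<sigma> * y / (\<sigma> + y) = D * y - D * y * y / (\<sigma> + y)"
      using y \<sigma> by (simp add: field_simps)
    ultimately have "D * y - e * y \<le> D * \<sigma> * y / (\<sigma> + y)" by simp
    then have "p * (s - 1) \<le> f s" by (simp add: f_def D_def y_def algebra_simps)
    moreover have "w0 - a * tb \<le> w (s, t) - (f s + g t)"
      using st calculation \<open>\<rho> \<le> r\<close> by (intro main) auto
    ultimately show ?thesis by (simp add: g_def algebra_simps)
  qed
  ultimately show ?thesis by blast
qed

text \<open>The term \<open>\<sigma> / (1 - s)\<close> keeps the contact point off the vertex, where a subsolution satisfies no
  Hamilton-Jacobi inequality, and only increases the slope beyond \<open>p1\<close>.\<close>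

lemma slope_lower:
  assumes sub: "sep_strict_subsol h {1 - r<..<1} {tb - \<eta><..<tb + \<eta>} \<delta> u"
    and pos: "0 < r" "0 < \<eta>" "0 < \<theta>" "0 < C" "0 < \<kappa>"
    and contu: "continuous_on ({1 - r..1} \<times> {tb - \<eta>..tb + \<eta>}) u"
    and contv: "continuous_on ({1 - r..1} \<times> {\<tau>b - \<theta>..\<tau>b + \<theta>}) v"
    and dbl: "\<And>s t \<tau>. s \<in> {1 - r..1} \<Longrightarrow> t \<in> {tb - \<eta>..tb + \<eta>} \<Longrightarrow> \<tau> \<in> {\<tau>b - \<theta>..\<tau>b + \<theta>} \<Longrightarrow>
      u (s, t) - v (s, \<tau>) - C * (t - \<tau>)^2 \<le> u (1, tb) - v (1, \<tau>b) - C * (tb - \<tau>b)^2"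
    and h: "\<And>s q. s \<in> {1 - r<..<1} \<Longrightarrow> p1 \<le> q \<Longrightarrow> - \<delta> + \<kappa> < 2 * C * (tb - \<tau>b) + h s q"
  shows "\<exists>\<rho>>0. \<rho> \<le> r \<and> \<rho> \<le> \<theta> \<and> (\<forall>s\<in>{1 - \<rho>..1}. \<forall>\<tau>\<in>{\<tau>b - \<rho>..\<tau>b + \<rho>}.
    v (1, \<tau>b) + 2 * C * (tb - \<tau>b) * (\<tau> - \<tau>b) - C * (\<tau> - \<tau>b)^2 + p1 * (s - 1) \<le> v (s, \<tau>))"
proof -
  define a where "a = 2 * C * (tb - \<tau>b)"
  define M where "M = u (1, tb) - v (1, \<tau>b) - C * (tb - \<tau>b)^2"
  \<comment> \<open>The time width is such that \<open>(4 * C + 2) * e \<le> \<kappa>\<close>, which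
    keeps the time derivative of the test function above \<open>a - \<kappa>\<close>.\<close>
  define e where "e = min \<eta> (\<kappa> / (4 * C + 2))"
  have e: "0 < e" "e \<le> \<eta>" using pos by (auto simp: e_def)
  have "e \<le> \<kappa> / (4 * C + 2)" by (simp add: e_def)
  then have e\<kappa>: "(4 * C + 2) * e \<le> \<kappa>"
    using pos by (subst (asm) pos_le_divide_eq) (auto simp: mult.commute)
  have e8: "e^2 / 8 > 0" using e by simp
  have "(1, \<tau>b) \<in> {1 - r..1} \<times> {\<tau>b - \<theta>..\<tau>b + \<theta>}" using pos by auto
  from contv[unfolded continuous_on_iff, rule_format, OF this e8]
  obtain d where d: "d > 0" and dv:
    "\<And>z. z \<in> {1 - r..1} \<times> {\<tau>b - \<theta>..\<tau>b + \<theta>} \<Longrightarrow> dist z (1, \<tau>b) < d \<Longrightarrow> dist (v z) (v (1, \<tau>b)) < e^2 / 8"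
    by blast
  \<comment> \<open>These bounds make each of three errors at most \<open>e^2 / 8\<close>: the
    variation of \<open>v\<close>, the term \<open>p1 * (s - 1)\<close>, and the terms in
    \<open>\<tau> - \<tau>b\<close>, where \<open>\<rho> \<le> 1\<close> replaces a square by its
    base. Their sum stays below the \<open>e^2\<close> gained at the time ends.\<close>
  define X where "X = {d / 3, r, \<theta>, e, 1, e^2 / (8 * (\<bar>p1\<bar> + 1)), e^2 / (8 * (\<bar>a\<bar> + C + 1))}"
  define \<rho> where "\<rho> = Min X"
  have "e^2 / (8 * (\<bar>p1\<bar> + 1)) > 0" "e^2 / (8 * (\<bar>a\<bar> + C + 1)) > 0"
    using e(1) pos(4) by (simp_all add: add_nonneg_pos)
  then have "\<forall>x\<in>X. 0 < x" using pos(1,3) e(1) d by (simp add: X_def)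
  then have \<rho>0: "0 < \<rho>" unfolding \<rho>_def by (subst Min_gr_iff) (simp_all add: X_def)
  have \<rho>X: "\<rho> \<le> x" if "x \<in> X" for x
    using that unfolding \<rho>_def by (intro Min_le) (simp_all add: X_def)
  have \<rho>: "0 < \<rho>" "\<rho> \<le> d / 3" "\<rho> \<le> r" "\<rho> \<le> \<theta>" "\<rho> \<le> e" "\<rho> \<le> 1"
      "\<rho> \<le> e^2 / (8 * (\<bar>p1\<bar> + 1))" "\<rho> \<le> e^2 / (8 * (\<bar>a\<bar> + C + 1))"
    by (rule \<rho>0, (rule \<rho>X, simp add: X_def)+)
  have p1\<rho>: "\<bar>p1\<bar> * \<rho> \<le> e^2 / 8"
  proof -
    have "\<rho> * (8 * (\<bar>p1\<bar> + 1)) \<le> e^2" using \<rho>(7) by (subst (asm) pos_le_divide_eq) auto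
    then show ?thesis using \<rho>(1) by (simp add: algebra_simps)
  qed
  have a\<rho>: "\<bar>a\<bar> * \<rho> + C * \<rho> \<le> e^2 / 8"
  proof -
    have "\<rho> * (8 * (\<bar>a\<bar> + C + 1)) \<le> e^2" using \<rho>(8) pos by (subst (asm) pos_le_divide_eq) auto
    then show ?thesis using \<rho>(1) by (simp add: algebra_simps)
  qed
  have vclose: "\<bar>v (s, \<tau>) - v (1, \<tau>b)\<bar> < e^2 / 8" if "s \<in> {1 - \<rho>..1}" "\<tau> \<in> {\<tau>b - \<rho>..\<tau>b + \<rho>}" for s \<tau>
  proof -
    have "dist (s, \<tau>) (1, \<tau>b) \<le> \<bar>s - 1\<bar> + \<bar>\<tau> - \<tau>b\<bar>"
      unfolding dist_Pair_Pair dist_real_def using sqrt_sum_squares_le_sum_abs[of "\<bar>s - 1\<bar>" "\<bar>\<tau> - \<tau>b\<bar>"] by simp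
    also have "\<dots> < d" using that \<rho>(2) d by auto
    finally show ?thesis using dv[of "(s, \<tau>)"] that \<rho>(3,4) by (auto simp: dist_real_def)
  qed
  have "v (1, \<tau>b) + a * (\<tau>1 - \<tau>b) - C * (\<tau>1 - \<tau>b)^2 + p1 * (s1 - 1) \<le> v (s1, \<tau>1)"
    if s1: "s1 \<in> {1 - \<rho>..1}" and \<tau>1: "\<tau>1 \<in> {\<tau>b - \<rho>..\<tau>b + \<rho>}" for s1 \<tau>1
  proof (rule ccontr)
    assume neg: "\<not> ?thesis"
    \<comment> \<open>\<open>F - M\<close> is the claimed bound for \<open>v\<close> without its
      slope term. Expanding the square around \<open>\<tau>b\<close> identifies \<open>F\<close>
      with the value of \<open>u - C * (t - \<tau>1)^2\<close> at the vertex at time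
      \<open>tb\<close>.\<close>
    define F where "F = M + v (1, \<tau>b) + a * (\<tau>1 - \<tau>b) - C * (\<tau>1 - \<tau>b)^2"
    have F: "u (1, tb) - C * (tb - \<tau>1)^2 = F"
      by (simp add: F_def M_def a_def power2_eq_square algebra_simps)
    have dbl': "u (s, t) - C * (t - \<tau>1)^2 \<le> M + v (s, \<tau>1)"
      if "s \<in> {1 - r..1}" "t \<in> {tb - \<eta>..tb + \<eta>}" for s t
      using dbl[OF that, of \<tau>1] \<tau>1 \<rho> by (auto simp: M_def)
    have Flow: "M + v (1, \<tau>b) - e^2 / 8 \<le> F"
    proof -
      have "\<bar>\<tau>1 - \<tau>b\<bar> \<le> \<rho>" using \<tau>1 by auto
      then have "\<bar>a * (\<tau>1 - \<tau>b)\<bar> \<le> \<bar>a\<bar> * \<rho>" by (simp add: abs_mult mult_left_mono)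
      moreover have "(\<tau>1 - \<tau>b)^2 \<le> \<rho> * 1"
      proof -
        have "(\<tau>1 - \<tau>b)^2 \<le> \<rho>^2" using power_mono[OF \<open>\<bar>\<tau>1 - \<tau>b\<bar> \<le> \<rho>\<close>, of 2] by simp
        also have "\<dots> \<le> \<rho> * 1"
          unfolding power2_eq_square using \<rho>(1,6) by (intro mult_left_mono) auto
        finally show ?thesis .
      qed
      then have "C * (\<tau>1 - \<tau>b)^2 \<le> C * \<rho>" using pos by simp
      ultimately show ?thesis using a\<rho> by (simp add: F_def abs_le_iff)
    qed
    \<comment> \<open>At the vertex itself the bound is just maximality with \<open>t = tb\<close>,
      so a violation must occur inside the arc.\<close>
    have s1lt: "s1 < 1"
    proof (rule ccontr)
      assume "\<not> s1 < 1"
      then have "s1 = 1" using s1 by simp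
      with neg have "v (1, \<tau>1) < F - M" by (simp add: F_def)
      moreover have "F \<le> M + v (1, \<tau>1)" using dbl'[of 1 tb] F pos by simp
      ultimately show False by simp
    qed
    define y1 where "y1 = 1 - s1"
    have y1: "0 < y1" "y1 \<le> \<rho>" using s1 s1lt by (auto simp: y1_def)
    \<comment> \<open>The size of the violation at \<open>s1\<close>, capped so that the drop at the
      time ends also covers it. Maximality transfers this deficit of \<open>v\<close> to
      \<open>u\<close>.\<close>
    define m where "m = min (F - M + p1 * (s1 - 1) - v (s1, \<tau>1)) (e^2 / 2)"
    have m: "0 < m" using neg e by (auto simp: m_def F_def)
    have me: "m \<le> e^2 / 2" "m \<le> F - M + p1 * (s1 - 1) - v (s1, \<tau>1)"
      unfolding m_def by (rule min.cobounded2 min.cobounded1)+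
    define g where "g = (\<lambda>t. C * (t - \<tau>1)^2 + 1 * (t - tb)^2 + 0 * t)"
    define g' where "g' = (\<lambda>t. 2 * C * (t - \<tau>1) + 2 * 1 * (t - tb) + 0)"
    have g: "C1_on UNIV g g'" unfolding g_def g'_def by (rule C1_on_quadratic)
    have base: "u (s, t) - g t \<le> M + v (s, \<tau>1) - (t - tb)^2"
      if "s \<in> {1 - r..1}" "t \<in> {tb - \<eta>..tb + \<eta>}" for s t
      using dbl'[OF that] by (simp add: g_def)
    have vs: "v (s, \<tau>1) - p1 * (s - 1) \<le> v (1, \<tau>b) + e^2 / 4" if "s \<in> {s1..1}" for s
    proof -
      have "\<bar>p1 * (s - 1)\<bar> \<le> \<bar>p1\<bar> * \<rho>"
        using that y1 unfolding abs_mult by (intro mult_left_mono) (auto simp: y1_def)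
      moreover have "\<bar>v (s, \<tau>1) - v (1, \<tau>b)\<bar> < e^2 / 8" using that s1 \<tau>1 by (intro vclose) auto
      ultimately show ?thesis using p1\<rho> by linarith
    qed
    have ub: "u (s, t) - g t - p1 * (s - 1) \<le> F + e^2 / 2 - (t - tb)^2"
      if "s \<in> {s1..1}" "t \<in> {tb - e..tb + e}" for s t
    proof -
      have "u (s, t) - g t \<le> M + v (s, \<tau>1) - (t - tb)^2"
        using that s1 \<rho>(3) e by (intro base) auto
      then show ?thesis using vs[OF that(1)] Flow zero_le_power2[of e] by linarith
    qed
    have "continuous_on {s1..1} (\<lambda>s. u (s, tb))"
    proof (rule continuous_on_compose2[OF contu])
      show "continuous_on {s1..1} (\<lambda>s. (s, tb))" by (intro continuous_intros)
    qed (use s1 \<rho> pos in auto)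
    then have "continuous_on {s1..1} (\<lambda>s. u (s, tb) - p1 * (s - 1))" by (intro continuous_intros)
    from this[unfolded continuous_on_iff, rule_format, of 1 "m / 4"] s1lt m
    obtain d' where d': "d' > 0" and dd:
      "\<And>s. s \<in> {s1..1} \<Longrightarrow> dist s 1 < d' \<Longrightarrow>
        dist (u (s, tb) - p1 * (s - 1)) (u (1, tb) - p1 * (1 - 1)) < m / 4"
      by auto
    have d'': "u (1, tb) - m / 4 < u (s, tb) - p1 * (s - 1)"
      if "s \<in> {s1..1}" "1 - s < d'" for s
    proof -
      have "dist (u (s, tb) - p1 * (s - 1)) (u (1, tb) - p1 * (1 - 1)) < m / 4"
        by (rule dd) (use that in \<open>auto simp: dist_real_def\<close>)
      then have "\<bar>u (s, tb) - p1 * (s - 1) - u (1, tb)\<bar> < m / 4" by (simp add: dist_real_def)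
      then show ?thesis by linarith
    qed
    \<comment> \<open>At distance \<open>y3\<close> from the vertex continuity costs less than
      \<open>m / 4\<close>, and \<open>\<sigma>\<close> is chosen so that the barrier costs exactly
      \<open>m / 4\<close> there. At the smaller distance \<open>y2\<close> the barrier is at least
      \<open>e^2 + m\<close>, which exceeds anything \<open>u\<close> can gain.\<close>
    define y3 where "y3 = min (d' / 2) (y1 / 2)"
    have y3: "0 < y3" "y3 < d'" "y3 < y1" using d' y1 by (auto simp: y3_def)
    define \<sigma> where "\<sigma> = m * y3 / 4"
    have \<sigma>: "0 < \<sigma>" "\<sigma> / y3 = m / 4" using m y3 by (auto simp: \<sigma>_def)
    define y2 where "y2 = min (y3 / 2) (\<sigma> / (e^2 + m))"
    have em: "e^2 + m > 0" using e m by (intro add_pos_pos) auto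
    have y2: "0 < y2" "y2 < y3" using y3 \<sigma> em by (auto simp: y2_def)
    have "y2 \<le> \<sigma> / (e^2 + m)" by (simp add: y2_def)
    then have \<sigma>y2: "e^2 + m \<le> \<sigma> / y2"
      using em y2 by (simp add: pos_le_divide_eq mult.commute)
    define f where "f = (\<lambda>s. p1 * (s - 1) + \<sigma> / (1 - s))"
    define f' where "f' = (\<lambda>s. p1 + \<sigma> / (1 - s)^2)"
    have f: "C1_on {..<1} f f'" unfolding f_def f'_def by (rule C1_on_barrier_in)
    have at3: "F - m / 2 < u (1 - y3, tb) - (f (1 - y3) + g tb)"
    proof -
      have "u (1, tb) - m / 4 < u (1 - y3, tb) - p1 * ((1 - y3) - 1)"
        by (rule d'') (use y3 in \<open>auto simp: y1_def\<close>)
      moreover have "u (1, tb) - g tb = F" using F by (simp add: g_def)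
      moreover have "f (1 - y3) = p1 * ((1 - y3) - 1) + m / 4" using \<sigma>(2) by (simp add: f_def)
      ultimately show ?thesis using m by linarith
    qed
    have S: "{s1<..<1 - y2} \<subseteq> {1 - r<..<1}" "{tb - e<..<tb + e} \<subseteq> {tb - \<eta><..<tb + \<eta>}"
      using s1 \<rho> y2 e by auto
    have S': "{s1..1 - y2} \<subseteq> {..<1}" "{tb - e..tb + e} \<subseteq> UNIV" using y2 by auto
    have cu: "continuous_on ({s1..1 - y2} \<times> {tb - e..tb + e}) u"
      by (rule continuous_on_subset[OF contu]) (use s1 \<rho> y2 e in auto)
    have p3: "1 - y3 \<in> {s1..1 - y2}" "tb \<in> {tb - e..tb + e}"
      using y2 y3 e by (auto simp: y1_def)
    obtain s t where st: "s \<in> {s1<..<1 - y2}" "t \<in> {tb - e<..<tb + e}"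
      and le: "g' t + h s (f' s) \<le> - \<delta>"
    proof (rule sep_strict_subsol_box[OF sub S cu f S'(1) g S'(2) p3])
      fix x t assume xt: "x \<in> {s1..1 - y2}" "t \<in> {tb - e..tb + e}"
        and "x = s1 \<or> x = 1 - y2 \<or> t = tb - e \<or> t = tb + e"
      then consider "x = s1" | "x = 1 - y2" | "(t - tb)^2 = e^2" by fastforce
      then have "u (x, t) - (f x + g t) \<le> F - m / 2"
      proof cases
        case 1
        have "u (x, t) - g t \<le> M + v (x, \<tau>1) - (t - tb)^2"
          using xt s1 \<rho> y2 e by (intro base) auto
        moreover have "0 \<le> \<sigma> / (1 - x)" "0 \<le> (t - tb)^2" using \<sigma> 1 s1lt by auto
        moreover have "m \<le> F - M + p1 * (x - 1) - v (x, \<tau>1)" using 1 me(2) by simp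
        ultimately show ?thesis using m unfolding f_def by linarith
      next
        case 2
        have "u (x, t) - g t - p1 * (x - 1) \<le> F + e^2 / 2 - (t - tb)^2"
          using xt y2 by (intro ub) auto
        moreover have "f x = p1 * (x - 1) + \<sigma> / y2" using 2 by (simp add: f_def)
        moreover have "0 \<le> (t - tb)^2" "0 \<le> e^2" by auto
        ultimately show ?thesis using \<sigma>y2 m me by linarith
      next
        case 3
        have "u (x, t) - g t - p1 * (x - 1) \<le> F + e^2 / 2 - (t - tb)^2"
          using xt y2 by (intro ub) auto
        moreover have "0 \<le> \<sigma> / (1 - x)" using \<sigma> xt y2 by auto
        ultimately show ?thesis using 3 m me(1) by (simp add: f_def)
      qed
      then show "u (x, t) - (f x + g t) < u (1 - y3, tb) - (f (1 - y3) + g tb)" using at3 by linarith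
    qed
    \<comment> \<open>The slope at the contact point exceeds \<open>p1\<close>, so
      \<open>a + h\<close> lies above \<open>- \<delta> + \<kappa>\<close>; the time derivative
      falls short of \<open>a\<close> by at most \<open>\<kappa>\<close>, and strictness
      fails.\<close>
    have "p1 \<le> f' s" using \<sigma> by (simp add: f'_def)
    moreover have "s \<in> {1 - r<..<1}" using st S by blast
    ultimately have "- \<delta> + \<kappa> < a + h s (f' s)" unfolding a_def by (intro h)
    moreover have "a - \<kappa> \<le> g' t"
    proof -
      have "C * (tb - e) \<le> C * t" "C * \<tau>1 \<le> C * (\<tau>b + e)"
        using pos st \<tau>1 \<rho> by (auto intro!: mult_left_mono)
      moreover have "tb - e \<le> t" using st by auto
      ultimately show ?thesis using e\<kappa> by (simp add: g'_def a_def algebra_simps)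
    qed
    ultimately show False using le by linarith
  qed
  then show ?thesis unfolding a_def using \<rho> by blast
qed

section \<open>Doubling the space variable inside an arc\<close>

text \<open>Penalizing \<open>n * (x - x')^2\<close> produces nearly equal slopes for both
  functions. Coercivity bounds them, so along a subsequence both inequalities pass to the limit at
  one common slope \<open>q\<close>, where \<open>a + h sb q\<close> would be at most
  \<open>- \<delta>\<close> and at least 0.\<close>

lemma interior_doubling:
  assumes sub: "sep_strict_subsol h {sb - r<..<sb + r} {tb - \<eta><..<tb + \<eta>} \<delta> u"
    and sup: "sep_supersol h {sb - r<..<sb + r} {\<tau>b - \<theta><..<\<tau>b + \<theta>} v"
    and pos: "0 < r" "0 < \<eta>" "0 < \<theta>" "0 < \<delta>"
    and contu: "continuous_on ({sb - r..sb + r} \<times> {tb - \<eta>..tb + \<eta>}) u"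
    and contv: "continuous_on ({sb - r..sb + r} \<times> {\<tau>b - \<theta>..\<tau>b + \<theta>}) v"
    and conth: "continuous_on ({sb - r..sb + r} \<times> UNIV) (\<lambda>(s, p). h s p)"
    and coer: "\<And>K. \<exists>R. \<forall>s\<in>{sb - r..sb + r}. \<forall>p. R \<le> \<bar>p\<bar> \<longrightarrow> K \<le> h s p"
    and dbl: "\<And>s t \<tau>. s \<in> {sb - r..sb + r} \<Longrightarrow> t \<in> {tb - \<eta>..tb + \<eta>} \<Longrightarrow> \<tau> \<in> {\<tau>b - \<theta>..\<tau>b + \<theta>} \<Longrightarrow>
      u (s, t) - v (s, \<tau>) - C * (t - \<tau>)^2 \<le> u (sb, tb) - v (sb, \<tau>b) - C * (tb - \<tau>b)^2"
  shows False
proof -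
  define K where "K = ({sb - r..sb + r} \<times> {tb - \<eta>..tb + \<eta>}) \<times> ({sb - r..sb + r} \<times> {\<tau>b - \<theta>..\<tau>b + \<theta>})"
  define zb where "zb = ((sb, tb), (sb, \<tau>b))"
  have zb: "zb \<in> K" using pos by (auto simp: K_def zb_def)
  have K: "compact K" by (auto simp: K_def intro!: compact_Times)
  \<comment> \<open>The squares make the base point the only maximizer on the diagonal
    \<open>x = x'\<close>, so maximizers of the penalized problems must converge to it.\<close>
  define \<Psi> where "\<Psi> = (\<lambda>z::(real \<times> real) \<times> (real \<times> real). u (fst z) - v (snd z)
    - C * (snd (fst z) - snd (snd z))^2
    - ((fst (fst z) - sb)^2 + (snd (fst z) - tb)^2 + (snd (snd z) - \<tau>b)^2))"
  define M where "M = \<Psi> zb"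
  have cu: "continuous_on K (\<lambda>z. u (fst z))"
    by (rule continuous_on_compose2[OF contu continuous_on_fst[OF continuous_on_id]]) (auto simp: K_def)
  have cv: "continuous_on K (\<lambda>z. v (snd z))"
    by (rule continuous_on_compose2[OF contv continuous_on_snd[OF continuous_on_id]]) (auto simp: K_def)
  have c\<Psi>: "continuous_on K \<Psi>" unfolding \<Psi>_def by (intro continuous_intros cu cv)
  define \<Phi> where "\<Phi> = (\<lambda>n z. \<Psi> z - real n * (fst (fst z) - fst (snd z))^2)"
  have "\<exists>z\<in>K. \<forall>y\<in>K. \<Phi> n y \<le> \<Phi> n z" for n
  proof (rule continuous_attains_sup[OF K])
    show "continuous_on K (\<Phi> n)" unfolding \<Phi>_def by (intro continuous_intros c\<Psi>)
  qed (use zb in blast)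
  then obtain Z where Z: "\<And>n. Z n \<in> K" "\<And>n y. y \<in> K \<Longrightarrow> \<Phi> n y \<le> \<Phi> n (Z n)" by metis
  obtain B where B: "\<And>z. z \<in> K \<Longrightarrow> \<Psi> z \<le> B"
    using continuous_attains_sup[OF K _ c\<Psi>] zb by (metis empty_iff)
  obtain l \<phi> where l: "l \<in> K" and \<phi>: "strict_mono (\<phi> :: nat \<Rightarrow> nat)" and lim: "(Z \<circ> \<phi>) \<longlonglongrightarrow> l"
    using K[unfolded compact_def, rule_format, of Z] Z(1) by auto
  define N where "N = (\<lambda>n. real (\<phi> n))"
  have Nn: "real n \<le> N n" for n using seq_suble[OF \<phi>, of n] by (simp add: N_def)
  define s t s' \<tau> where "s = (\<lambda>n. fst (fst (Z (\<phi> n))))" and "t = (\<lambda>n. snd (fst (Z (\<phi> n))))"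
    and "s' = (\<lambda>n. fst (snd (Z (\<phi> n))))" and "\<tau> = (\<lambda>n. snd (snd (Z (\<phi> n))))"
  have Zeq: "Z (\<phi> n) = ((s n, t n), (s' n, \<tau> n))" for n
    by (simp add: s_def t_def s'_def \<tau>_def)
  obtain ls lt ls' l\<tau> where leq: "l = ((ls, lt), (ls', l\<tau>))" by (metis surj_pair)
  have lims: "s \<longlonglongrightarrow> ls" "t \<longlonglongrightarrow> lt" "s' \<longlonglongrightarrow> ls'" "\<tau> \<longlonglongrightarrow> l\<tau>"
    using tendsto_fst[OF tendsto_fst[OF lim]] tendsto_snd[OF tendsto_fst[OF lim]]
      tendsto_fst[OF tendsto_snd[OF lim]] tendsto_snd[OF tendsto_snd[OF lim]]
    by (simp_all add: s_def t_def s'_def \<tau>_def leq comp_def)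
  have MZ: "M + N n * (s n - s' n)^2 \<le> \<Psi> (Z (\<phi> n))" for n
    using Z(2)[OF zb, of "\<phi> n"] by (simp add: \<Phi>_def M_def zb_def N_def Zeq)
  \<comment> \<open>Comparison with the base point bounds the penalty by \<open>B - M\<close>
    uniformly in \<open>n\<close>, hence both space variables have the same limit.\<close>
  have "n * (s n - s' n)^2 \<le> B - M" for n
  proof -
    have "n * (s n - s' n)^2 \<le> N n * (s n - s' n)^2" using Nn by (intro mult_right_mono) auto
    then show ?thesis using MZ[of n] B[OF Z(1)[of "\<phi> n"]] by linarith
  qed
  then have bd: "(s n - s' n)^2 \<le> (B - M) / n" if "n > 0" for n
    using that by (simp add: pos_le_divide_eq mult.commute)
  have "(\<lambda>n. (s n - s' n)^2) \<longlonglongrightarrow> 0"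
  proof (rule tendsto_sandwich[OF _ _ tendsto_const lim_const_over_n[of "B - M"]])
    show "\<forall>\<^sub>F n in sequentially. (s n - s' n)^2 \<le> (B - M) / n"
      using eventually_gt_at_top[of 0] by eventually_elim (rule bd)
  qed auto
  moreover have "(\<lambda>n. (s n - s' n)^2) \<longlonglongrightarrow> (ls - ls')^2" by (intro tendsto_intros lims)
  ultimately have "(ls - ls')^2 = 0" using LIMSEQ_unique by blast
  then have ls': "ls' = ls" by simp
  have "(\<lambda>n. \<Psi> ((Z \<circ> \<phi>) n)) \<longlonglongrightarrow> \<Psi> l"
    by (rule continuous_on_tendsto_compose[OF c\<Psi> lim l]) (simp add: Z)
  moreover have "M \<le> \<Psi> ((Z \<circ> \<phi>) n)" for n
  proof -
    have "0 \<le> N n * (s n - s' n)^2" by (simp add: N_def)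
    then show ?thesis using MZ[of n] by simp
  qed
  ultimately have "M \<le> \<Psi> l" by (meson LIMSEQ_le_const)
  \<comment> \<open>The limit lies on the diagonal, where \<open>dbl\<close> applies; together with
    \<open>M \<le> \<Psi> l\<close> this makes all three squares vanish.\<close>
  moreover have "\<Psi> l \<le> M - ((ls - sb)^2 + (lt - tb)^2 + (l\<tau> - \<tau>b)^2)"
    using dbl[of ls lt l\<tau>] l by (simp add: \<Psi>_def M_def zb_def leq ls' K_def)
  ultimately have sq: "(ls - sb)^2 + (lt - tb)^2 + (l\<tau> - \<tau>b)^2 \<le> 0" by linarith
  have "0 \<le> (ls - sb)^2" "0 \<le> (lt - tb)^2" "0 \<le> (l\<tau> - \<tau>b)^2" by auto
  with sq have "(ls - sb)^2 = 0" "(lt - tb)^2 = 0" "(l\<tau> - \<tau>b)^2 = 0" by linarith+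
  then have eqs: "ls = sb" "lt = tb" "l\<tau> = \<tau>b" by auto
  have limb: "s \<longlonglongrightarrow> sb" "t \<longlonglongrightarrow> tb" "s' \<longlonglongrightarrow> sb" "\<tau> \<longlonglongrightarrow> \<tau>b"
    using lims ls' eqs by simp_all
  \<comment> \<open>The slope contributed by the penalty. The subsolution sees an additional
    \<open>2 * (s n - sb)\<close>, since only the first space variable is localized in
    \<open>\<Psi>\<close>.\<close>
  define p where "p = (\<lambda>n. 2 * N n * (s n - s' n))"
  define a where "a = 2 * C * (tb - \<tau>b)"
  have ev: "\<forall>\<^sub>F n in sequentially. 2 * C * (t n - \<tau> n) + 2 * (t n - tb) + h (s n) (p n + 2 * (s n - sb)) \<le> - \<delta>
     \<and> 0 \<le> 2 * C * (t n - \<tau> n) - 2 * (\<tau> n - \<tau>b) + h (s' n) (p n)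
     \<and> s n \<in> {sb - r<..<sb + r} \<and> s' n \<in> {sb - r<..<sb + r}"
  proof -
    have "\<forall>\<^sub>F n in sequentially. s n \<in> {sb - r<..<sb + r}"
      by (rule topological_tendstoD[OF lims(1)]) (use pos eqs in auto)
    moreover have "\<forall>\<^sub>F n in sequentially. s' n \<in> {sb - r<..<sb + r}"
      by (rule topological_tendstoD[OF lims(3)]) (use pos eqs ls' in auto)
    moreover have "\<forall>\<^sub>F n in sequentially. t n \<in> {tb - \<eta><..<tb + \<eta>}"
      by (rule topological_tendstoD[OF lims(2)]) (use pos eqs in auto)
    moreover have "\<forall>\<^sub>F n in sequentially. \<tau> n \<in> {\<tau>b - \<theta><..<\<tau>b + \<theta>}"
      by (rule topological_tendstoD[OF lims(4)]) (use pos eqs in auto)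
    ultimately show ?thesis
    proof eventually_elim
      case (elim n)
      have max: "\<Phi> (\<phi> n) ((x, y), (x', y')) \<le> \<Phi> (\<phi> n) ((s n, t n), (s' n, \<tau> n))"
        if "x \<in> {sb - r<..<sb + r}" "y \<in> {tb - \<eta><..<tb + \<eta>}"
          "x' \<in> {sb - r<..<sb + r}" "y' \<in> {\<tau>b - \<theta><..<\<tau>b + \<theta>}" for x y x' y'
        using Z(2)[of "((x, y), (x', y'))" "\<phi> n"] that by (simp add: K_def Zeq)
      have "(2 * C * (t n - \<tau> n) + 2 * 1 * (t n - tb) + 0)
          + h (s n) (2 * N n * (s n - s' n) + 2 * 1 * (s n - sb) + 0) \<le> - \<delta>"
      proof (rule sep_strict_subsolD[OF sub subset_refl subset_refl
            C1_on_subset[OF C1_on_quadratic[of "N n" "s' n" 1 sb 0]]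
            C1_on_subset[OF C1_on_quadratic[of C "\<tau> n" 1 tb 0]] elim(1,3)])
        fix x y assume "x \<in> {sb - r<..<sb + r}" "y \<in> {tb - \<eta><..<tb + \<eta>}"
        from max[OF this elim(2,4)]
        show "u (x, y) - (N n * (x - s' n)^2 + 1 * (x - sb)^2 + 0 * x
            + (C * (y - \<tau> n)^2 + 1 * (y - tb)^2 + 0 * y))
          \<le> u (s n, t n) - (N n * (s n - s' n)^2 + 1 * (s n - sb)^2 + 0 * s n
            + (C * (t n - \<tau> n)^2 + 1 * (t n - tb)^2 + 0 * t n))"
          by (simp add: \<Phi>_def \<Psi>_def N_def)
      qed auto
      moreover have "0 \<le> (2 * (- C) * (\<tau> n - t n) + 2 * (- 1) * (\<tau> n - \<tau>b) + 0)
          + h (s' n) (2 * (- N n) * (s' n - s n) + 2 * 0 * (s' n - sb) + 0)"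
      proof (rule sep_supersolD[OF sup subset_refl subset_refl
            C1_on_subset[OF C1_on_quadratic[of "- N n" "s n" 0 sb 0]]
            C1_on_subset[OF C1_on_quadratic[of "- C" "t n" "- 1" \<tau>b 0]] elim(2,4)])
        fix x y assume "x \<in> {sb - r<..<sb + r}" "y \<in> {\<tau>b - \<theta><..<\<tau>b + \<theta>}"
        from max[OF elim(1,3) this]
        show "v (s' n, \<tau> n) - (- N n * (s' n - s n)^2 + 0 * (s' n - sb)^2 + 0 * s' n
            + (- C * (\<tau> n - t n)^2 + - 1 * (\<tau> n - \<tau>b)^2 + 0 * \<tau> n))
          \<le> v (x, y) - (- N n * (x - s n)^2 + 0 * (x - sb)^2 + 0 * x
            + (- C * (y - t n)^2 + - 1 * (y - \<tau>b)^2 + 0 * y))"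
          by (simp add: \<Phi>_def \<Psi>_def N_def power2_commute[of x "s n"] power2_commute[of y "t n"]
              power2_commute[of "s' n" "s n"] power2_commute[of "\<tau> n" "t n"])
      qed auto
      ultimately show ?case using elim by (simp add: p_def algebra_simps)
    qed
  qed
  have ta: "(\<lambda>n. 2 * C * (t n - \<tau> n)) \<longlonglongrightarrow> a" unfolding a_def
    by (intro tendsto_intros limb)
  have t0: "(\<lambda>n. 2 * (t n - tb)) \<longlonglongrightarrow> 0" "(\<lambda>n. 2 * (\<tau> n - \<tau>b)) \<longlonglongrightarrow> 0" "(\<lambda>n. 2 * (s n - sb)) \<longlonglongrightarrow> 0"
    using tendsto_mult_left[OF tendsto_diff[OF limb(2) tendsto_const[of tb]], of 2]
      tendsto_mult_left[OF tendsto_diff[OF limb(4) tendsto_const[of \<tau>b]], of 2]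
      tendsto_mult_left[OF tendsto_diff[OF limb(1) tendsto_const[of sb]], of 2] by simp_all
  \<comment> \<open>A strict subsolution keeps \<open>h\<close> at the contact slopes below
    \<open>1 - a\<close> for large \<open>n\<close>, so coercivity confines these slopes to a
    compact interval.\<close>
  obtain R where R: "\<And>s p. s \<in> {sb - r..sb + r} \<Longrightarrow> R \<le> \<bar>p\<bar> \<Longrightarrow> - a + 1 \<le> h s p"
    using coer[of "- a + 1"] by blast
  have "(\<lambda>n. 2 * C * (t n - \<tau> n) + 2 * (t n - tb)) \<longlonglongrightarrow> a + 0" by (intro tendsto_add ta t0)
  then have "\<forall>\<^sub>F n in sequentially. a - 1 < 2 * C * (t n - \<tau> n) + 2 * (t n - tb)"
    by (intro order_tendstoD) auto
  with ev have bdd: "\<forall>\<^sub>F n in sequentially. \<bar>p n + 2 * (s n - sb)\<bar> \<le> R"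
  proof eventually_elim
    case (elim n)
    show ?case
    proof (rule ccontr)
      assume "\<not> ?thesis"
      then have "- a + 1 \<le> h (s n) (p n + 2 * (s n - sb))" using elim by (intro R) auto
      with elim pos show False by linarith
    qed
  qed
  then obtain n0 where n0: "\<And>n. n \<ge> n0 \<Longrightarrow> p n + 2 * (s n - sb) \<in> {- R..R}"
    unfolding eventually_sequentially by (fastforce simp: abs_le_iff)
  obtain q \<psi> where \<psi>: "strict_mono (\<psi> :: nat \<Rightarrow> nat)"
    and q: "((\<lambda>n. p (n + n0) + 2 * (s (n + n0) - sb)) \<circ> \<psi>) \<longlonglongrightarrow> q"
    using compact_Icc[of "- R" R, unfolded compact_def, rule_format,
        of "\<lambda>n. p (n + n0) + 2 * (s (n + n0) - sb)"] n0 by auto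
  define k where "k = (\<lambda>n. \<psi> n + n0)"
  have k: "filterlim k sequentially sequentially"
    unfolding k_def by (intro filterlim_compose[OF filterlim_add_const_nat_at_top filterlim_subseq[OF \<psi>]])
  have q: "(\<lambda>n. p (k n) + 2 * (s (k n) - sb)) \<longlonglongrightarrow> q" using q by (simp add: k_def comp_def)
  have limk: "(\<lambda>n. s (k n)) \<longlonglongrightarrow> sb" "(\<lambda>n. s' (k n)) \<longlonglongrightarrow> sb"
     "(\<lambda>n. 2 * C * (t (k n) - \<tau> (k n))) \<longlonglongrightarrow> a" "(\<lambda>n. 2 * (t (k n) - tb)) \<longlonglongrightarrow> 0"
     "(\<lambda>n. 2 * (\<tau> (k n) - \<tau>b)) \<longlonglongrightarrow> 0" "(\<lambda>n. 2 * (s (k n) - sb)) \<longlonglongrightarrow> 0"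
    using filterlim_compose[OF lims(1) k] filterlim_compose[OF lims(3) k]
      filterlim_compose[OF ta k] filterlim_compose[OF t0(1) k] filterlim_compose[OF t0(2) k]
      filterlim_compose[OF t0(3) k] by (simp_all add: eqs ls')
  have evk: "\<forall>\<^sub>F n in sequentially. 2 * C * (t (k n) - \<tau> (k n)) + 2 * (t (k n) - tb)
        + h (s (k n)) (p (k n) + 2 * (s (k n) - sb)) \<le> - \<delta>
     \<and> 0 \<le> 2 * C * (t (k n) - \<tau> (k n)) - 2 * (\<tau> (k n) - \<tau>b) + h (s' (k n)) (p (k n))
     \<and> s (k n) \<in> {sb - r<..<sb + r} \<and> s' (k n) \<in> {sb - r<..<sb + r}"
    using eventually_compose_filterlim[OF ev k] .
  have inK: "(sb, q) \<in> {sb - r..sb + r} \<times> UNIV" using pos by auto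
  have "(\<lambda>n. (\<lambda>(s, p). h s p) (s (k n), p (k n) + 2 * (s (k n) - sb))) \<longlonglongrightarrow> (\<lambda>(s, p). h s p) (sb, q)"
    by (rule continuous_on_tendsto_compose[OF conth tendsto_Pair[OF limk(1) q] inK])
      (use evk in \<open>auto elim!: eventually_mono\<close>)
  then have "(\<lambda>n. 2 * C * (t (k n) - \<tau> (k n)) + 2 * (t (k n) - tb)
      + h (s (k n)) (p (k n) + 2 * (s (k n) - sb))) \<longlonglongrightarrow> a + 0 + h sb q"
    by (intro tendsto_add limk) simp
  then have "a + 0 + h sb q \<le> - \<delta>"
    by (rule tendsto_upperbound) (use evk in \<open>auto elim!: eventually_mono\<close>)
  moreover have pk: "(\<lambda>n. p (k n)) \<longlonglongrightarrow> q" using tendsto_diff[OF q limk(6)] by simp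
  have "(\<lambda>n. (\<lambda>(s, p). h s p) (s' (k n), p (k n))) \<longlonglongrightarrow> (\<lambda>(s, p). h s p) (sb, q)"
    by (rule continuous_on_tendsto_compose[OF conth tendsto_Pair[OF limk(2) pk] inK])
      (use evk in \<open>auto elim!: eventually_mono\<close>)
  then have "(\<lambda>n. 2 * C * (t (k n) - \<tau> (k n)) - 2 * (\<tau> (k n) - \<tau>b) + h (s' (k n)) (p (k n)))
      \<longlonglongrightarrow> a - 0 + h sb q"
    by (intro tendsto_add tendsto_diff limk) simp
  then have "0 \<le> a - 0 + h sb q"
    by (rule tendsto_lowerbound) (use evk in \<open>auto elim!: eventually_mono\<close>)
  ultimately show False using pos by linarith
qed

section \<open>Slopes of the Hamiltonian at a vertex\<close>

text \<open>The infimum at \<open>s0\<close> is at most the supremum over \<open>s\<close>. The work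
  is to establish the bounds that make the real \<open>INF\<close> and \<open>SUP\<close>
  meaningful: coercivity with compactness from below, and the values at slope 0 from above.\<close>

lemma arc_const_slope:
  assumes cont: "continuous_on ({0..1} \<times> UNIV) (\<lambda>(s, p). h s p)"
    and coer: "\<And>K. \<exists>R. \<forall>s\<in>{0..1}. \<forall>p. R \<le> \<bar>p\<bar> \<longrightarrow> K \<le> h s p"
    and s0: "s0 \<in> {0..1}" and z: "- arc_const h < z"
  obtains p where "h s0 p < z"
proof -
  obtain R where R: "\<And>s p. s \<in> {0..1} \<Longrightarrow> R \<le> \<bar>p\<bar> \<Longrightarrow> 0 \<le> h s p"
    using coer[of 0] by blast
  have bdd: "bdd_below (range (h s))" if s: "s \<in> {0..1}" for s
  proof -
    have "continuous_on {- \<bar>R\<bar>..\<bar>R\<bar>} (\<lambda>p. (\<lambda>(s, p). h s p) (s, p))"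
      by (rule continuous_on_compose2[OF cont]) (use s in \<open>auto intro!: continuous_on_Pair\<close>)
    then have "continuous_on {- \<bar>R\<bar>..\<bar>R\<bar>} (h s)" by simp
    moreover have "{- \<bar>R\<bar>..\<bar>R\<bar>} \<noteq> {}" by auto
    ultimately obtain q where q: "\<And>p. p \<in> {- \<bar>R\<bar>..\<bar>R\<bar>} \<Longrightarrow> h s q \<le> h s p"
      using continuous_attains_inf[OF compact_Icc] by blast
    have "min 0 (h s q) \<le> h s p" for p
    proof (cases "p \<in> {- \<bar>R\<bar>..\<bar>R\<bar>}")
      case True
      then show ?thesis using q[OF True] by linarith
    next
      case False
      then have "R \<le> \<bar>p\<bar>" by auto
      then show ?thesis using R[OF s] by (simp add: min.coboundedI1)
    qed
    then show ?thesis by (intro bdd_belowI) auto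
  qed
  have "continuous_on {0..1} (\<lambda>s. (\<lambda>(s, p). h s p) (s, 0))"
    by (rule continuous_on_compose2[OF cont]) (auto intro!: continuous_on_Pair)
  then have "continuous_on {0..1} (\<lambda>s. h s 0)" by simp
  then have "bdd_above ((\<lambda>s. h s 0) ` {0..1})"
    by (intro bounded_imp_bdd_above compact_imp_bounded compact_continuous_image compact_Icc)
  then obtain B where B: "\<And>s. s \<in> {0..1} \<Longrightarrow> h s 0 \<le> B"
    unfolding bdd_above_def by blast
  have "bdd_above ((\<lambda>s. INF p. h s p) ` {0..1})"
  proof (rule bdd_aboveI2)
    fix s :: real assume s: "s \<in> {0..1}"
    show "(INF p. h s p) \<le> B" using cINF_lower[OF bdd[OF s], of 0] B[OF s] by simp
  qed
  then have "(INF p. h s0 p) \<le> (SUP s\<in>{0..1}. INF p. h s p)" using s0 by (intro cSUP_upper)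
  also have "\<dots> < z" using z by (simp add: arc_const_def)
  finally obtain p where "h s0 p < z" using cInf_lessD[of "range (h s0)" z] by auto
  then show ?thesis using that by blast
qed

text \<open>\<open>p1\<close> is the point to the right of \<open>p0\<close> where the convex function \<open>a + h 1\<close> climbs back to
  \<open>- \<delta> / 2\<close>.\<close>

lemma critical_slope:
  fixes h :: "real \<Rightarrow> real \<Rightarrow> real" and a p0 :: real
  assumes cont: "continuous_on ({0..1} \<times> UNIV) (\<lambda>(s, p). h s p)"
    and conv: "convex_on UNIV (h 1)"
    and coer: "\<And>K. \<exists>R. \<forall>s\<in>{0..1}. \<forall>p. R \<le> \<bar>p\<bar> \<longrightarrow> K \<le> h s p"
    and \<delta>: "0 < \<delta>" and p0: "a + h 1 p0 < - \<delta> / 2"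
  obtains p1 e r where "p0 \<le> p1" "0 < e" "0 < r" "r \<le> 1"
    "\<And>s q. s \<in> {1 - r<..<1} \<Longrightarrow> q \<in> {p0 - e..p1 + e} \<Longrightarrow> a + h s q < - (\<delta> / 4)"
    "\<And>s q. s \<in> {1 - r<..<1} \<Longrightarrow> p1 \<le> q \<Longrightarrow> - \<delta> + \<delta> / 4 < a + h s q"
proof -
  obtain R where R: "\<And>s p. s \<in> {0..1} \<Longrightarrow> R \<le> \<bar>p\<bar> \<Longrightarrow> - a \<le> h s p"
    using coer[of "- a"] by blast
  \<comment> \<open>Beyond \<open>L\<close> coercivity already gives \<open>a + h \<ge> 0\<close>,
    so the level is reached before \<open>L\<close> and uniform continuity is required only on a
    compact range. The further unit in \<open>L + 1\<close> accommodates the enlargement of the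
    slope interval by \<open>e \<le> 1\<close>.\<close>
  define L where "L = max \<bar>R\<bar> \<bar>p0\<bar> + 1"
  have L: "\<bar>R\<bar> < L" "\<bar>p0\<bar> < L" by (auto simp: L_def)
  have "continuous_on {p0..L} (\<lambda>p. (\<lambda>(s, p). h s p) (1, p))"
    by (rule continuous_on_compose2[OF cont]) (auto intro!: continuous_on_Pair)
  then have c1: "continuous_on {p0..L} (h 1)" by simp
  have p0L: "p0 \<le> L" using L by linarith
  have "- a \<le> h 1 L" by (rule R) (use L in auto)
  then have "- \<delta> / 2 - a \<le> h 1 L" using \<delta> by linarith
  moreover have "h 1 p0 \<le> - \<delta> / 2 - a" using p0 by simp
  ultimately obtain p1 where p1: "p0 \<le> p1" "p1 \<le> L" and h1: "h 1 p1 = - \<delta> / 2 - a"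
    using IVT'[OF _ _ p0L c1, of "- \<delta> / 2 - a"] by blast
  have p01: "p0 < p1" using h1 p0 p1(1) by (cases "p0 = p1") auto
  have below: "h 1 q \<le> - \<delta> / 2 - a" if q: "p0 \<le> q" "q \<le> p1" for q
  proof -
    have "h 1 q \<le> max (h 1 p0) (h 1 p1)"
    proof -
      define \<mu> where "\<mu> = (q - p0) / (p1 - p0)"
      have \<mu>: "0 \<le> \<mu>" "\<mu> \<le> 1" using q p01 by (auto simp: \<mu>_def)
      have "\<mu> * (p1 - p0) = q - p0" using p01 by (simp add: \<mu>_def)
      then have "q = (1 - \<mu>) *\<^sub>R p0 + \<mu> *\<^sub>R p1" by (simp add: algebra_simps)
      then have "h 1 q \<le> (1 - \<mu>) * h 1 p0 + \<mu> * h 1 p1"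
        using convex_onD[OF conv \<mu>, of p0 p1] by simp
      also have "\<dots> \<le> max (h 1 p0) (h 1 p1)"
        using \<mu> by (intro convex_bound_le) auto
      finally show ?thesis .
    qed
    then show ?thesis using h1 p0 by linarith
  qed
  \<comment> \<open>A lower value at some \<open>q > p1\<close>, together with the low value at
    \<open>p0\<close>, would by convexity push \<open>h 1 p1\<close> strictly below its
    level.\<close>
  have above: "- \<delta> / 2 - a \<le> h 1 q" if q: "p1 \<le> q" for q
  proof (rule ccontr)
    assume neg: "\<not> ?thesis"
    then have "p1 < q" using q h1 by (cases "p1 = q") auto
    define \<mu> where "\<mu> = (p1 - p0) / (q - p0)"
    have \<mu>: "0 < \<mu>" "\<mu> < 1" using p01 \<open>p1 < q\<close> by (auto simp: \<mu>_def)
    have "\<mu> * (q - p0) = p1 - p0" using p01 \<open>p1 < q\<close> by (simp add: \<mu>_def)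
    then have "p1 = (1 - \<mu>) *\<^sub>R p0 + \<mu> *\<^sub>R q" by (simp add: algebra_simps)
    then have "h 1 p1 \<le> (1 - \<mu>) * h 1 p0 + \<mu> * h 1 q"
      using convex_onD[OF conv, of \<mu> p0 q] \<mu> by simp
    also have "\<dots> < - \<delta> / 2 - a"
      using \<mu> neg p0 by (intro convex_bound_lt) auto
    finally show False using h1 by simp
  qed
  have "compact ({0..1::real} \<times> {- (L + 1)..L + 1})" by (intro compact_Times compact_Icc)
  moreover have "continuous_on ({0..1} \<times> {- (L + 1)..L + 1}) (\<lambda>(s, p). h s p)"
    by (rule continuous_on_subset[OF cont]) auto
  ultimately have "uniformly_continuous_on ({0..1} \<times> {- (L + 1)..L + 1}) (\<lambda>(s, p). h s p)"
    by (intro compact_uniformly_continuous)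
  from this[unfolded uniformly_continuous_on_def, rule_format, of "\<delta> / 4"] \<delta>
  obtain d where d: "0 < d" and dd: "\<And>z z'. z \<in> {0..1} \<times> {- (L + 1)..L + 1} \<Longrightarrow>
      z' \<in> {0..1} \<times> {- (L + 1)..L + 1} \<Longrightarrow> dist z' z < d \<Longrightarrow>
      dist ((\<lambda>(s, p). h s p) z') ((\<lambda>(s, p). h s p) z) < \<delta> / 4"
    by auto
  have close: "\<bar>h s q - h 1 q'\<bar> < \<delta> / 4"
    if "s \<in> {0..1}" "1 - s < d / 2" "\<bar>q\<bar> \<le> L + 1" "\<bar>q'\<bar> \<le> L + 1" "\<bar>q - q'\<bar> < d / 2" for s q q'
  proof -
    have "dist (s, q) (1, q') \<le> \<bar>s - 1\<bar> + \<bar>q - q'\<bar>"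
      unfolding dist_Pair_Pair dist_real_def
      using sqrt_sum_squares_le_sum_abs[of "\<bar>s - 1\<bar>" "\<bar>q - q'\<bar>"] by simp
    also have "\<dots> < d" using that by auto
    finally have "dist (h s q) (h 1 q') < \<delta> / 4" using dd[of "(1, q')" "(s, q)"] that by (auto simp: abs_le_iff)
    then show ?thesis by (simp add: dist_real_def)
  qed
  \<comment> \<open>An error below \<open>\<delta> / 4\<close> turns the level
    \<open>- \<delta> / 2\<close> at the vertex into the bounds \<open>- \<delta> / 4\<close> and
    \<open>- 3 * \<delta> / 4\<close> nearby.\<close>
  show ?thesis
  proof (rule that[of p1 "min (d / 3) 1" "min (d / 2) 1"])
    show "p0 \<le> p1" "0 < min (d / 3) 1" "0 < min (d / 2) 1" "min (d / 2) 1 \<le> 1" using p1 d by auto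
    fix s q assume s: "s \<in> {1 - min (d / 2) 1<..<1}"
    have "d / 3 < d / 2" using d by simp
    {
      assume q: "q \<in> {p0 - min (d / 3) 1..p1 + min (d / 3) 1}"
      \<comment> \<open>The projection of \<open>q\<close> onto the interval from \<open>p0\<close>
        to \<open>p1\<close>, where \<open>below\<close> is available.\<close>
      define q' where "q' = max p0 (min p1 q)"
      have q': "p0 \<le> q'" "q' \<le> p1" "\<bar>q - q'\<bar> \<le> d / 3" "\<bar>q\<bar> \<le> L + 1" "\<bar>q'\<bar> \<le> L + 1"
        using q p1 L d unfolding q'_def by (auto simp: max_def min_def abs_if split: if_splits)
      have "\<bar>h s q - h 1 q'\<bar> < \<delta> / 4"
        by (rule close) (use s q' \<open>d / 3 < d / 2\<close> in auto)
      then show "a + h s q < - (\<delta> / 4)" using below[OF q'(1,2)] by linarith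
    next
      assume q: "p1 \<le> q"
      show "- \<delta> + \<delta> / 4 < a + h s q"
      proof (cases "q \<le> L")
        case True
        have "\<bar>h s q - h 1 q\<bar> < \<delta> / 4"
          by (rule close) (use s q p01 True L d in auto)
        then show ?thesis using above[OF q] by linarith
      next
        case False
        then have "- a \<le> h s q" using s L by (intro R) auto
        then show ?thesis using \<delta> by linarith
      qed
    }
  qed
qed

text \<open>\<open>slope_lower\<close> first provides the slope \<open>p1\<close> given by
  \<open>critical_slope\<close>; \<open>slope_improve\<close> then replaces it by \<open>p0\<close>,
  which is the stronger bound because \<open>s - 1 \<le> 0\<close>. The price is the factor 2 in the
  quadratic term.\<close>

lemma vertex_slope:
  assumes sub: "sep_strict_subsol h {0<..<1} {tb - \<eta><..<tb + \<eta>} \<delta> u"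
    and sup: "sep_supersol h {0<..<1} {\<tau>b - \<theta><..<\<tau>b + \<theta>} v"
    and pos: "0 < \<eta>" "0 < \<theta>" "0 < C" "0 < \<delta>"
    and contu: "continuous_on ({0..1} \<times> {tb - \<eta>..tb + \<eta>}) u"
    and contv: "continuous_on ({0..1} \<times> {\<tau>b - \<theta>..\<tau>b + \<theta>}) v"
    and dbl: "\<And>s t \<tau>. s \<in> {0..1} \<Longrightarrow> t \<in> {tb - \<eta>..tb + \<eta>} \<Longrightarrow> \<tau> \<in> {\<tau>b - \<theta>..\<tau>b + \<theta>} \<Longrightarrow>
      u (s, t) - v (s, \<tau>) - C * (t - \<tau>)^2 \<le> u (1, tb) - v (1, \<tau>b) - C * (tb - \<tau>b)^2"
    and cont: "continuous_on ({0..1} \<times> UNIV) (\<lambda>(s, p). h s p)"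
    and conv: "convex_on UNIV (h 1)"
    and coer: "\<And>K. \<exists>R. \<forall>s\<in>{0..1}. \<forall>p. R \<le> \<bar>p\<bar> \<longrightarrow> K \<le> h s p"
    and a: "a = 2 * C * (tb - \<tau>b)" and p0: "a + h 1 p0 < - \<delta> / 2"
  shows "\<exists>\<rho>>0. \<rho> \<le> 1 \<and> \<rho> \<le> \<theta> \<and> (\<forall>s\<in>{1 - \<rho>..1}. \<forall>\<tau>\<in>{\<tau>b - \<rho>..\<tau>b + \<rho>}.
    v (1, \<tau>b) + a * (\<tau> - \<tau>b) - 2 * C * (\<tau> - \<tau>b)^2 + p0 * (s - 1) \<le> v (s, \<tau>))"
proof -
  obtain p1 e r where r: "p0 \<le> p1" "0 < e" "0 < r" "r \<le> 1"
    and lt: "\<And>s q. s \<in> {1 - r<..<1} \<Longrightarrow> q \<in> {p0 - e..p1 + e} \<Longrightarrow> a + h s q < - (\<delta> / 4)"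
    and gt: "\<And>s q. s \<in> {1 - r<..<1} \<Longrightarrow> p1 \<le> q \<Longrightarrow> - \<delta> + \<delta> / 4 < a + h s q"
    using critical_slope[OF cont conv coer pos(4) p0] by metis
  have r': "{1 - r<..<1} \<subseteq> {0<..<1}" "{1 - r..1} \<subseteq> {0..1}" using r by auto
  have \<delta>4: "0 < \<delta> / 4" using pos by simp
  have "\<exists>\<rho>>0. \<rho> \<le> r \<and> \<rho> \<le> \<theta> \<and> (\<forall>s\<in>{1 - \<rho>..1}. \<forall>\<tau>\<in>{\<tau>b - \<rho>..\<tau>b + \<rho>}.
      v (1, \<tau>b) + 2 * C * (tb - \<tau>b) * (\<tau> - \<tau>b) - C * (\<tau> - \<tau>b)^2 + p1 * (s - 1) \<le> v (s, \<tau>))"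
  proof (rule slope_lower[OF sep_strict_subsol_subset[OF sub r'(1) subset_refl] r(3) pos(1,2,3) \<delta>4])
    show "continuous_on ({1 - r..1} \<times> {tb - \<eta>..tb + \<eta>}) u"
      by (rule continuous_on_subset[OF contu]) (use r' in blast)
    show "continuous_on ({1 - r..1} \<times> {\<tau>b - \<theta>..\<tau>b + \<theta>}) v"
      by (rule continuous_on_subset[OF contv]) (use r' in blast)
    show "u (s, t) - v (s, \<tau>) - C * (t - \<tau>)^2 \<le> u (1, tb) - v (1, \<tau>b) - C * (tb - \<tau>b)^2"
      if "s \<in> {1 - r..1}" "t \<in> {tb - \<eta>..tb + \<eta>}" "\<tau> \<in> {\<tau>b - \<theta>..\<tau>b + \<theta>}" for s t \<tau>
      using that r' by (intro dbl) auto
    show "- \<delta> + \<delta> / 4 < 2 * C * (tb - \<tau>b) + h s q" if "s \<in> {1 - r<..<1}" "p1 \<le> q" for s q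
      using gt[OF that] a by simp
  qed
  then obtain \<rho>1 where \<rho>1: "0 < \<rho>1" "\<rho>1 \<le> r" "\<rho>1 \<le> \<theta>" and low: "\<And>s \<tau>. s \<in> {1 - \<rho>1..1} \<Longrightarrow>
      \<tau> \<in> {\<tau>b - \<rho>1..\<tau>b + \<rho>1} \<Longrightarrow> v (1, \<tau>b) + a * (\<tau> - \<tau>b) - C * (\<tau> - \<tau>b)^2 + p1 * (s - 1) \<le> v (s, \<tau>)"
    unfolding a by blast
  \<comment> \<open>The time interval is shortened so that
    \<open>4 * C * \<mu> \<le> \<delta> / 4\<close>, the smallness that \<open>slope_improve\<close>
    demands.\<close>
  define \<mu> where "\<mu> = min \<rho>1 (\<delta> / 4 / (4 * C))"
  have \<mu>: "0 < \<mu>" "\<mu> \<le> \<rho>1" using \<rho>1 pos by (auto simp: \<mu>_def)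
  have "\<mu> \<le> \<delta> / 4 / (4 * C)" unfolding \<mu>_def by (rule min.cobounded2)
  then have \<mu>\<delta>: "4 * C * \<mu> \<le> \<delta> / 4" using pos by (simp add: pos_le_divide_eq mult_ac)
  have "\<exists>\<rho>>0. \<rho> \<le> \<rho>1 \<and> (\<forall>s\<in>{1 - \<rho>..1}. \<forall>t\<in>{\<tau>b - \<mu>..\<tau>b + \<mu>}.
      v (1, \<tau>b) + a * (t - \<tau>b) - 2 * C * (t - \<tau>b)^2 + p0 * (s - 1) \<le> v (s, t))"
  proof (rule slope_improve[OF _ \<rho>1(1) \<mu>(1) pos(3) r(2,1) _ _ \<mu>\<delta>])
    show "sep_supersol h {1 - \<rho>1<..<1} {\<tau>b - \<mu><..<\<tau>b + \<mu>} v"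
      by (rule sep_supersol_subset[OF sup]) (use \<rho>1 \<mu> r in auto)
    show "continuous_on ({1 - \<rho>1..1} \<times> {\<tau>b - \<mu>..\<tau>b + \<mu>}) v"
      by (rule continuous_on_subset[OF contv]) (use \<rho>1 \<mu> r in auto)
    show "a + h s q < - (\<delta> / 4)" if "s \<in> {1 - \<rho>1<..<1}" "q \<in> {p0 - e..p1 + e}" for s q
      using that \<rho>1 by (intro lt) auto
    show "v (1, \<tau>b) + a * (t - \<tau>b) - C * (t - \<tau>b)^2 + p1 * (s - 1) \<le> v (s, t)"
      if "s \<in> {1 - \<rho>1..1}" "t \<in> {\<tau>b - \<mu>..\<tau>b + \<mu>}" for s t
      using that \<mu> by (intro low) auto
  qed
  then obtain \<rho>2 where \<rho>2: "0 < \<rho>2" "\<rho>2 \<le> \<rho>1" and fin: "\<And>s t. s \<in> {1 - \<rho>2..1} \<Longrightarrow>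
      t \<in> {\<tau>b - \<mu>..\<tau>b + \<mu>} \<Longrightarrow> v (1, \<tau>b) + a * (t - \<tau>b) - 2 * C * (t - \<tau>b)^2 + p0 * (s - 1) \<le> v (s, t)"
    by blast
  show ?thesis
  proof (intro exI[of _ "min \<rho>2 \<mu>"] conjI ballI)
    show "v (1, \<tau>b) + a * (\<tau> - \<tau>b) - 2 * C * (\<tau> - \<tau>b)^2 + p0 * (s - 1) \<le> v (s, \<tau>)"
      if "s \<in> {1 - min \<rho>2 \<mu>..1}" "\<tau> \<in> {\<tau>b - min \<rho>2 \<mu>..\<tau>b + min \<rho>2 \<mu>}" for s \<tau>
      using that by (intro fin) auto
  qed (use \<rho>2 \<rho>1 \<mu> r in auto)
qed

section \<open>The time penalty, and compactness and continuity on the network\<close>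

lemma C1_on_hyperbola:
  "C1_on {..<T} (\<lambda>t. c / (T - t)) (\<lambda>t. c / (T - t)^2)"
proof (rule C1_onI)
  show "continuous_on {..<T} (\<lambda>t. c / (T - t)^2)" by (auto intro!: continuous_intros)
qed (auto intro!: derivative_eq_intros simp: power2_eq_square)

lemma continuous_on_along:
  assumes "continuous_on (network_set E \<times> I) w" "\<gamma> \<in> E" "path \<gamma>" "J \<subseteq> I"
  shows "continuous_on ({0..1} \<times> J) (along w \<gamma>)"
proof -
  have "continuous_on ({0..1} \<times> J) (\<lambda>z. \<gamma> (fst z))"
    by (rule continuous_on_compose2[OF assms(3)[unfolded path_def] continuous_on_fst[OF continuous_on_id]])
      auto
  then have "continuous_on ({0..1} \<times> J) (\<lambda>z. (\<gamma> (fst z), snd z))"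
    by (intro continuous_on_Pair continuous_on_snd continuous_on_id)
  then have "continuous_on ({0..1} \<times> J) (\<lambda>z. w (\<gamma> (fst z), snd z))"
    by (rule continuous_on_compose2[OF assms(1)])
      (use assms(2,4) in \<open>auto simp: network_set_def path_image_def\<close>)
  then show ?thesis by (simp add: along_def case_prod_unfold)
qed

lemma uniformly_continuous_on_time:
  fixes w :: "'a::metric_space \<times> real \<Rightarrow> real"
  assumes "uniformly_continuous_on (X \<times> I) w" "J \<subseteq> I" "0 < e"
  obtains d where "0 < d" "\<And>x t t'. x \<in> X \<Longrightarrow> t \<in> J \<Longrightarrow> t' \<in> J \<Longrightarrow> \<bar>t' - t\<bar> < d \<Longrightarrow>
    \<bar>w (x, t') - w (x, t)\<bar> < e"
proof -
  from assms(1)[unfolded uniformly_continuous_on_def, rule_format, OF assms(3)]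
  obtain d where d: "0 < d" "\<And>z z'. z \<in> X \<times> I \<Longrightarrow> z' \<in> X \<times> I \<Longrightarrow> dist z' z < d \<Longrightarrow>
    dist (w z') (w z) < e" by blast
  have "\<bar>w (x, t') - w (x, t)\<bar> < e" if "x \<in> X" "t \<in> J" "t' \<in> J" "\<bar>t' - t\<bar> < d" for x t t'
  proof -
    have "(x, t) \<in> X \<times> I" "(x, t') \<in> X \<times> I" "dist (x, t') (x, t) < d"
      using that assms(2) by (auto simp: dist_Pair_Pair dist_real_def)
    from d(2)[OF this] show ?thesis by (simp add: dist_real_def)
  qed
  then show ?thesis using d(1) that by blast
qed

lemma compact_network_set: "network E \<Longrightarrow> compact (network_set E)"
  unfolding network_set_def network_def
  by (intro compact_UN) (auto intro: compact_path_image simple_path_imp_path)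

section \<open>Comparison on the network: penalization, doubling in time, and contradiction at the
  maximum\<close>

theorem theorem7p1:
  fixes E :: "(real \<Rightarrow> 'a::euclidean_space) set"
    and H :: "(real \<Rightarrow> 'a) \<Rightarrow> real \<Rightarrow> real \<Rightarrow> real"
    and c :: "'a \<Rightarrow> real"
    and T0 :: real and T1 :: ereal
    and u v :: "'a \<times> real \<Rightarrow> real"
  assumes "0 \<le> T0" and "ereal T0 < T1"
    and "network E"
    and "hamiltonians E H"
    and "flux_limiter E H c"
    and "uniformly_continuous_on (network_set E \<times> time_dom T0 T1) u"
    and "uniformly_continuous_on (network_set E \<times> time_dom T0 T1) v"
    and "HJ_subsolution E H c T0 T1 u"
    and "HJ_supersolution E H c T0 T1 v"
    and "\<forall>x\<in>network_set E. u (x, T0) \<le> v (x, T0)"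
  shows "\<forall>x\<in>network_set E. \<forall>t\<in>time_dom T0 T1. u (x, t) \<le> v (x, t)"
proof (rule ccontr)
  assume "\<not> ?thesis"
  then obtain x0 t0 where x0: "x0 \<in> network_set E" and t0: "t0 \<in> time_dom T0 T1"
    and uv0: "v (x0, t0) < u (x0, t0)" by force
  define \<Gamma> where "\<Gamma> = network_set E"
  have T0t0: "T0 < t0"
    using t0 uv0 assms(10) x0 by (cases "t0 = T0") (auto simp: time_dom_def)
  \<comment> \<open>Stopping before \<open>T1\<close>, which may be infinite, gives a compact
    space-time domain.\<close>
  obtain T' where T': "t0 < T'" "ereal T' < T1"
    using t0 ereal_dense2[of "ereal t0" T1] by (auto simp: time_dom_def)
  have dom: "{T0..T'} \<subseteq> time_dom T0 T1" "{T0<..<T'} \<subseteq> open_times T0 T1"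
  proof -
    have "ereal t < T1" if "t \<le> T'" for t
      using that T'(2) by (meson ereal_less_eq(3) le_less_trans)
    then show "{T0..T'} \<subseteq> time_dom T0 T1" "{T0<..<T'} \<subseteq> open_times T0 T1"
      by (auto simp: time_dom_def open_times_def)
  qed
  have cu: "continuous_on (\<Gamma> \<times> {T0..T'}) u" and cv: "continuous_on (\<Gamma> \<times> {T0..T'}) v"
    using dom unfolding \<Gamma>_def
    by (auto intro!: continuous_on_subset[OF uniformly_continuous_imp_continuous[OF assms(6)]]
        continuous_on_subset[OF uniformly_continuous_imp_continuous[OF assms(7)]])
  have comp: "compact (\<Gamma> \<times> {T0..T'})"
    unfolding \<Gamma>_def by (intro compact_Times compact_Icc compact_network_set assms)
  have "bounded (u ` (\<Gamma> \<times> {T0..T'}))" "bounded (v ` (\<Gamma> \<times> {T0..T'}))"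
    by (auto intro!: compact_imp_bounded compact_continuous_image comp cu cv)
  then obtain B1 B2 where B12: "\<And>z. z \<in> \<Gamma> \<times> {T0..T'} \<Longrightarrow> \<bar>u z\<bar> \<le> B1"
      "\<And>z. z \<in> \<Gamma> \<times> {T0..T'} \<Longrightarrow> \<bar>v z\<bar> \<le> B2"
    unfolding bounded_real by (meson imageI)
  define B where "B = max B1 B2"
  have B: "\<bar>u z\<bar> \<le> B" "\<bar>v z\<bar> \<le> B" if "z \<in> \<Gamma> \<times> {T0..T'}" for z
    using B12[OF that] by (auto simp: B_def)
  have B0: "0 \<le> B" using B(1)[of "(x0, t0)"] x0 T0t0 T' by (auto simp: \<Gamma>_def)
  define m where "m = u (x0, t0) - v (x0, t0)"
  have m: "0 < m" using uv0 by (simp add: m_def)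
  \<comment> \<open>Normalized so that \<open>G t0 = m / 2\<close>: half of the gap at
    \<open>(x0, t0)\<close> survives the penalty.\<close>
  define \<kappa> where "\<kappa> = m / 2 * (T' - t0)"
  have \<kappa>: "0 < \<kappa>" using m T' by (simp add: \<kappa>_def)
  define G where "G = (\<lambda>t. \<kappa> / (T' - t))"
  define G' where "G' = (\<lambda>t. \<kappa> / (T' - t)^2)"
  have G: "C1_on {..<T'} G G'" unfolding G_def G'_def by (rule C1_on_hyperbola)
  have Gt0: "G t0 = m / 2" 
    unfolding G_def \<kappa>_def using T' by (intro nonzero_mult_div_cancel_right) auto
  have Gpos: "0 < G t" if "t < T'" for t using that \<kappa> by (simp add: G_def)
  \<comment> \<open>The value of \<open>G'\<close> at \<open>T0\<close>, where this increasing
    derivative is smallest.\<close>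
  define \<delta> where "\<delta> = \<kappa> / (T' - T0)^2"
  have \<delta>: "0 < \<delta>" using \<kappa> T' T0t0 by (simp add: \<delta>_def)
  have G'\<delta>: "\<delta> \<le> G' t" if "t \<in> {T0<..<T'}" for t
    unfolding \<delta>_def G'_def using that \<kappa> by (intro divide_left_mono power_mono mult_pos_pos) auto
  \<comment> \<open>The cut-off \<open>T\<close> stays beyond \<open>t0\<close> and before the pole
    of \<open>G\<close>, yet so near the pole that \<open>G T\<close> exceeds every possible value
    of \<open>u - v\<close>.\<close>
  define e where "e = min (\<kappa> / (2 * B + 1)) ((T' - t0) / 2)"
  have "0 < e" using T'(1) \<kappa> B0 by (simp add: e_def)
  moreover have "e \<le> (T' - t0) / 2" "e \<le> \<kappa> / (2 * B + 1)"
    unfolding e_def by (rule min.cobounded2 min.cobounded1)+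
  ultimately have e: "0 < e" "e \<le> (T' - t0) / 2" "e \<le> \<kappa> / (2 * B + 1)" by blast+
  define T where "T = T' - e"
  have T: "t0 < T" "T < T'" "T' - T \<le> \<kappa> / (2 * B + 1)"
    using e T'(1) by (simp_all add: T_def)
  have GT: "2 * B + 1 \<le> G T"
  proof -
    have "(T' - T) * (2 * B + 1) \<le> \<kappa>" using T(3) B0 by (simp add: pos_le_divide_eq)
    then show ?thesis using T(2) by (simp add: G_def pos_le_divide_eq mult.commute)
  qed
  have m2: "0 < m / 2" using m by simp
  obtain d1 where d1: "0 < d1" "\<And>x t t'. x \<in> \<Gamma> \<Longrightarrow> t \<in> {T0..T'} \<Longrightarrow> t' \<in> {T0..T'} \<Longrightarrow>
      \<bar>t' - t\<bar> < d1 \<Longrightarrow> \<bar>u (x, t') - u (x, t)\<bar> < m / 2"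
    using uniformly_continuous_on_time[OF assms(6) dom(1) m2] unfolding \<Gamma>_def by metis
  obtain d2 where d2: "0 < d2" "\<And>x t t'. x \<in> \<Gamma> \<Longrightarrow> t \<in> {T0..T'} \<Longrightarrow> t' \<in> {T0..T'} \<Longrightarrow>
      \<bar>t' - t\<bar> < d2 \<Longrightarrow> \<bar>v (x, t') - v (x, t)\<bar> < m / 2"
    using uniformly_continuous_on_time[OF assms(7) dom(1) m2] unfolding \<Gamma>_def by metis
  \<comment> \<open>\<open>C * d^2 = 2 * B + 1\<close> will force
    \<open>\<bar>tb - \<tau>b\<bar> < d\<close>. The bounds \<open>d1\<close> and \<open>d2\<close>
    then serve to exclude the initial time, and \<open>T' - T\<close> keeps \<open>\<tau>b\<close>
    away from \<open>T'\<close>.\<close>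
  define d where "d = min (min d1 d2) (T' - T)"
  have d: "0 < d" "d \<le> d1" "d \<le> d2" "d \<le> T' - T" using d1 d2 T by (auto simp: d_def)
  define C where "C = (2 * B + 1) / d^2"
  have C: "0 < C" "C * d^2 = 2 * B + 1" using B0 d by (auto simp: C_def)

  \<comment> \<open>The range of \<open>\<tau>\<close> extends past that of \<open>t\<close>, so
    that \<open>\<tau>\<close> close to \<open>t\<close> cannot reach the end of its
    interval.\<close>
  define K where "K = \<Gamma> \<times> {T0..T} \<times> {T0..T'}"
  define \<Phi> where "\<Phi> = (\<lambda>(x, t, \<tau>). u (x, t) - G t - v (x, \<tau>) - C * (t - \<tau>)^2)"
  have "compact K" unfolding K_def \<Gamma>_def
    by (intro compact_Times compact_Icc compact_network_set assms)
  moreover have "(x0, t0, t0) \<in> K" using x0 T0t0 T T' by (auto simp: K_def \<Gamma>_def)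
  moreover have "continuous_on K \<Phi>"
  proof -
    have c1: "continuous_on K (\<lambda>z. (fst z, fst (snd z)))" "continuous_on K (\<lambda>z. (fst z, snd (snd z)))"
      by (intro continuous_intros)+
    have "continuous_on K (\<lambda>z. u (fst z, fst (snd z)))"
      by (rule continuous_on_compose2[OF cu c1(1)]) (use T in \<open>auto simp: K_def\<close>)
    moreover have "continuous_on K (\<lambda>z. v (fst z, snd (snd z)))"
      by (rule continuous_on_compose2[OF cv c1(2)]) (use T in \<open>auto simp: K_def\<close>)
    moreover have "continuous_on K (\<lambda>z. G (fst (snd z)))"
      by (rule continuous_on_compose2[OF C1_on_continuous[OF G]
            continuous_on_fst[OF continuous_on_snd[OF continuous_on_id]]]) (use T in \<open>auto simp: K_def\<close>)
    ultimately show ?thesis unfolding \<Phi>_def case_prod_unfold by (intro continuous_intros)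
  qed
  ultimately obtain z where z: "z \<in> K" "\<And>y. y \<in> K \<Longrightarrow> \<Phi> y \<le> \<Phi> z"
    using continuous_attains_sup[of K \<Phi>] by (metis empty_iff)
  obtain xb tb \<tau>b where zeq: "z = (xb, tb, \<tau>b)" by (metis surj_pair)
  have xb: "xb \<in> \<Gamma>" and tb: "tb \<in> {T0..T}" and \<tau>b: "\<tau>b \<in> {T0..T'}"
    using z(1) by (auto simp: zeq K_def)
  have max: "u (x, t) - G t - v (x, \<tau>) - C * (t - \<tau>)^2 \<le> u (xb, tb) - G tb - v (xb, \<tau>b) - C * (tb - \<tau>b)^2"
    if "x \<in> \<Gamma>" "t \<in> {T0..T}" "\<tau> \<in> {T0..T'}" for x t \<tau>
    using z(2)[of "(x, t, \<tau>)"] that by (simp add: zeq K_def \<Phi>_def)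
  have mle: "m / 2 \<le> u (xb, tb) - G tb - v (xb, \<tau>b) - C * (tb - \<tau>b)^2"
  proof -
    have "u (x0, t0) - G t0 - v (x0, t0) - C * (t0 - t0)^2
        \<le> u (xb, tb) - G tb - v (xb, \<tau>b) - C * (tb - \<tau>b)^2"
      using x0 T0t0 T T'(1) by (intro max) (auto simp: \<Gamma>_def)
    moreover have "u (x0, t0) - G t0 - v (x0, t0) - C * (t0 - t0)^2 = m / 2"
      unfolding Gt0 by (simp add: m_def field_simps)
    ultimately show ?thesis by linarith
  qed
  have tT': "tb \<in> {T0..T'}" "tb < T'" using tb T by auto
  have Bb: "u (xb, tb) - v (xb, \<tau>b) \<le> 2 * B"
    using B(1)[of "(xb, tb)"] B(2)[of "(xb, \<tau>b)"] xb tT' \<tau>b by auto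
  have Csq: "0 \<le> C * (tb - \<tau>b)^2" using C by simp
  have close: "\<bar>tb - \<tau>b\<bar> < d"
  proof -
    have "C * (tb - \<tau>b)^2 < C * d^2" using mle Bb Gpos[OF tT'(2)] m unfolding C(2) by linarith
    then have "(tb - \<tau>b)^2 < d^2" by (rule mult_less_cancel_left_pos[OF C(1), THEN iffD1])
    then show ?thesis using d(1) power_less_imp_less_base[of "\<bar>tb - \<tau>b\<bar>" 2 d] by simp
  qed
  have init: "u (xb, T0) \<le> v (xb, T0)" using assms(10) xb by (simp add: \<Gamma>_def)
  \<comment> \<open>At the initial time the ordering of the data leaves only the oscillation of
    \<open>v\<close> over a time shorter than \<open>d\<close>, which is less than the
    \<open>m / 2\<close> required by \<open>mle\<close>.\<close>
  have "tb \<noteq> T0"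
  proof
    assume eq: "tb = T0"
    have "\<bar>v (xb, T0) - v (xb, \<tau>b)\<bar> < m / 2"
      using d2(2)[of xb \<tau>b T0] xb \<tau>b tT' close d eq by auto
    moreover have "u (xb, tb) = u (xb, T0)" using eq by simp
    ultimately show False using init mle Csq Gpos[OF tT'(2)] by linarith
  qed
  have "\<tau>b \<noteq> T0"
  proof
    assume eq: "\<tau>b = T0"
    have "\<bar>u (xb, tb) - u (xb, T0)\<bar> < m / 2"
      using d1(2)[of xb T0 tb] xb \<tau>b tT' close d eq by auto
    moreover have "v (xb, \<tau>b) = v (xb, T0)" using eq by simp
    ultimately show False using init mle Csq Gpos[OF tT'(2)] by linarith
  qed
  have "tb \<noteq> T" using mle Bb GT Csq m by auto
  have "\<tau>b \<noteq> T'" using close d(4) tb by auto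
  have tbI: "T0 < tb" "tb < T" and \<tau>bI: "T0 < \<tau>b" "\<tau>b < T'"
    using tb \<tau>b \<open>tb \<noteq> T0\<close> \<open>tb \<noteq> T\<close> \<open>\<tau>b \<noteq> T0\<close> \<open>\<tau>b \<noteq> T'\<close> by auto
  define \<eta> where "\<eta> = min (tb - T0) (T - tb)"
  define \<theta> where "\<theta> = min (\<tau>b - T0) (T' - \<tau>b)"
  have \<eta>: "0 < \<eta>" "{tb - \<eta>..tb + \<eta>} \<subseteq> {T0..T}" "{tb - \<eta><..<tb + \<eta>} \<subseteq> {T0<..<T'}"
    using tbI T by (auto simp: \<eta>_def)
  have \<theta>: "0 < \<theta>" "{\<tau>b - \<theta>..\<tau>b + \<theta>} \<subseteq> {T0..T'}" "{\<tau>b - \<theta><..<\<tau>b + \<theta>} \<subseteq> {T0<..<T'}"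
    using \<tau>bI by (auto simp: \<theta>_def)

  define w where "w = (\<lambda>\<gamma> (s, t). along u \<gamma> (s, t) - G t)"
  have path: "path \<gamma>" if "\<gamma> \<in> E" for \<gamma>
    using assms(3) that by (auto simp: network_def intro: simple_path_imp_path)
  have sub: "sep_strict_subsol (H \<gamma>) {0<..<1} {tb - \<eta><..<tb + \<eta>} \<delta> (w \<gamma>)" if \<gamma>: "\<gamma> \<in> E" for \<gamma>
    unfolding w_def
  proof (rule sep_strict_subsol_minus_time[OF viscosity_subsol_imp_sep G])
    show "viscosity_subsol (H \<gamma>) T0 T1 (along u \<gamma>)"
      using assms(8) \<gamma> by (simp add: HJ_subsolution_def)
  qed (use \<eta>(3) dom G'\<delta> in auto)
  have sup: "sep_supersol (H \<gamma>) {0<..<1} {\<tau>b - \<theta><..<\<tau>b + \<theta>} (along v \<gamma>)" if \<gamma>: "\<gamma> \<in> E" for \<gamma>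
  proof (rule sep_supersol_subset[OF viscosity_supersol_imp_sep])
    show "viscosity_supersol (H \<gamma>) T0 T1 (along v \<gamma>)"
      using assms(9) \<gamma> by (simp add: HJ_supersolution_def)
  qed (use \<theta>(3) dom in auto)
  have contw: "continuous_on ({0..1} \<times> {tb - \<eta>..tb + \<eta>}) (w \<gamma>)" if \<gamma>: "\<gamma> \<in> E" for \<gamma>
  proof -
    have "continuous_on ({0..1} \<times> {tb - \<eta>..tb + \<eta>}) (along u \<gamma>)"
      by (rule continuous_on_along[OF cu[unfolded \<Gamma>_def] \<gamma> path[OF \<gamma>]]) (use \<eta> T in force)
    moreover have "continuous_on ({0..1} \<times> {tb - \<eta>..tb + \<eta>}) (\<lambda>z. G (snd z))"
      by (rule continuous_on_compose2[OF C1_on_continuous[OF G] continuous_on_snd[OF continuous_on_id]])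
        (use \<eta>(2) T in force)
    ultimately show ?thesis unfolding w_def case_prod_unfold prod.collapse by (intro continuous_intros)
  qed
  have contv: "continuous_on ({0..1} \<times> {\<tau>b - \<theta>..\<tau>b + \<theta>}) (along v \<gamma>)" if \<gamma>: "\<gamma> \<in> E" for \<gamma>
    by (rule continuous_on_along[OF cv[unfolded \<Gamma>_def] \<gamma> path[OF \<gamma>] \<theta>(2)])
  have dbl: "w \<gamma> (s, t) - along v \<gamma> (s, \<tau>) - C * (t - \<tau>)^2
      \<le> w \<gamma> (sb, tb) - along v \<gamma> (sb, \<tau>b) - C * (tb - \<tau>b)^2"
    if "\<gamma> \<in> E" "\<gamma> sb = xb" "s \<in> {0..1}" "t \<in> {tb - \<eta>..tb + \<eta>}" "\<tau> \<in> {\<tau>b - \<theta>..\<tau>b + \<theta>}" for \<gamma> s sb t \<tau>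
  proof -
    have "\<gamma> s \<in> \<Gamma>" using that(1,3) unfolding \<Gamma>_def network_set_def path_image_def by blast
    moreover have "t \<in> {T0..T}" "\<tau> \<in> {T0..T'}" using that(4,5) \<eta>(2) \<theta>(2) by blast+
    ultimately show ?thesis using max[of "\<gamma> s" t \<tau>] that(2) by (simp add: w_def along_def)
  qed
  have contH: "continuous_on ({0..1} \<times> UNIV) (\<lambda>(s, p). H \<gamma> s p)"
    and convH: "s \<in> {0..1} \<Longrightarrow> convex_on UNIV (H \<gamma> s)"
    and coerH: "\<exists>R. \<forall>s\<in>{0..1}. \<forall>p. R \<le> \<bar>p\<bar> \<longrightarrow> k \<le> H \<gamma> s p" if "\<gamma> \<in> E" for \<gamma> s k
    using assms(4) that unfolding hamiltonians_def by blast+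

  obtain \<gamma>0 sb where \<gamma>0: "\<gamma>0 \<in> E" "sb \<in> {0..1}" "\<gamma>0 sb = xb"
    using xb by (auto simp: \<Gamma>_def network_set_def path_image_def)
  show False
  proof (cases "sb \<in> {0<..<1}")
    case True
    define r where "r = min sb (1 - sb)"
    have r: "0 < r" "{sb - r..sb + r} \<subseteq> {0..1}" "{sb - r<..<sb + r} \<subseteq> {0<..<1}"
      using True by (auto simp: r_def)
    show False
    proof (rule interior_doubling[OF sep_strict_subsol_subset[OF sub[OF \<gamma>0(1)] r(3) subset_refl]
          sep_supersol_subset[OF sup[OF \<gamma>0(1)] r(3) subset_refl] r(1) \<eta>(1) \<theta>(1) \<delta>])
      show "continuous_on ({sb - r..sb + r} \<times> {tb - \<eta>..tb + \<eta>}) (w \<gamma>0)"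
        by (rule continuous_on_subset[OF contw[OF \<gamma>0(1)]]) (use r in blast)
      show "continuous_on ({sb - r..sb + r} \<times> {\<tau>b - \<theta>..\<tau>b + \<theta>}) (along v \<gamma>0)"
        by (rule continuous_on_subset[OF contv[OF \<gamma>0(1)]]) (use r in blast)
      show "continuous_on ({sb - r..sb + r} \<times> UNIV) (\<lambda>(s, p). H \<gamma>0 s p)"
        by (rule continuous_on_subset[OF contH[OF \<gamma>0(1)]]) (use r in blast)
      show "\<exists>R. \<forall>s\<in>{sb - r..sb + r}. \<forall>p. R \<le> \<bar>p\<bar> \<longrightarrow> k \<le> H \<gamma>0 s p" for k
        using coerH[OF \<gamma>0(1), of k] r by blast
      show "w \<gamma>0 (s, t) - along v \<gamma>0 (s, \<tau>) - C * (t - \<tau>)^2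
          \<le> w \<gamma>0 (sb, tb) - along v \<gamma>0 (sb, \<tau>b) - C * (tb - \<tau>b)^2"
        if "s \<in> {sb - r..sb + r}" "t \<in> {tb - \<eta>..tb + \<eta>}" "\<tau> \<in> {\<tau>b - \<theta>..\<tau>b + \<theta>}" for s t \<tau>
        using that r(2) \<gamma>0 by (intro dbl) auto
    qed
  next
    case False
    then have "sb = 0 \<or> sb = 1" using \<gamma>0 by auto
    then have xbV: "xb \<in> vertices E"
      using \<gamma>0 by (auto simp: vertices_def pathstart_def pathfinish_def)
    have tbO: "tb \<in> open_times T0 T1" "\<tau>b \<in> open_times T0 T1"
      using tbI \<tau>bI T dom by auto
    define a where "a = 2 * C * (tb - \<tau>b)"
    \<comment> \<open>Maximality in \<open>t\<close> alone makes the doubling term plus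
      \<open>G\<close> a supertangent to \<open>u\<close> at the vertex, so the flux limiter bounds
      \<open>a + G' tb\<close>.\<close>
    have a\<delta>: "a + \<delta> \<le> c xb"
    proof -
      define \<psi> where "\<psi> = (\<lambda>t. C * (t - \<tau>b)^2 + 0 * (t - \<tau>b)^2 + 0 * t + G t)"
      have C1\<psi>: "C1_on {..<T'} \<psi> (\<lambda>t. 2 * C * (t - \<tau>b) + 2 * 0 * (t - \<tau>b) + 0 + G' t)"
        unfolding \<psi>_def by (intro C1_on_add C1_on_subset[OF C1_on_quadratic] G) auto
      have "supertangent_on (open_times T0 T1) (\<lambda>t. u (xb, t)) tb \<psi>"
        unfolding supertangent_on_def
      proof
        show "C1_near \<psi> tb" using C1_near_real[OF C1\<psi>] tT' by auto
        show "\<forall>\<^sub>F t in at tb within open_times T0 T1. u (xb, t) - \<psi> t \<le> u (xb, tb) - \<psi> tb"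
          unfolding eventually_at_topological
        proof (intro exI[of _ "{T0<..<T}"] conjI ballI impI)
          fix t assume "t \<in> {T0<..<T}"
          then show "u (xb, t) - \<psi> t \<le> u (xb, tb) - \<psi> tb"
            using max[of xb t \<tau>b] xb \<tau>b by (simp add: \<psi>_def)
        qed (use tbI in auto)
      qed
      then have "deriv \<psi> tb \<le> c xb"
        using assms(8) xbV tbO unfolding HJ_subsolution_def by blast
      moreover have "deriv \<psi> tb = a + G' tb"
        using C1\<psi> tT' unfolding C1_on_def a_def by (intro DERIV_imp_deriv) auto
      moreover have "\<delta> \<le> G' tb" using tbI T by (intro G'\<delta>) auto
      ultimately show ?thesis by linarith
    qed
    \<comment> \<open>Maximality in \<open>\<tau>\<close> alone gives a subtangent to
      \<open>v\<close> with the same derivative \<open>a\<close>, now strictly below the flux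
      limiter; this activates the vertex condition for supersolutions.\<close>
    have "\<exists>\<phi>. subtangent_on (open_times T0 T1) (\<lambda>t. v (xb, t)) \<tau>b \<phi> \<and> deriv \<phi> \<tau>b < c xb"
    proof (intro exI conjI)
      let ?\<phi> = "\<lambda>t. - C * (t - tb)^2 + 0 * (t - tb)^2 + 0 * t"
      show "subtangent_on (open_times T0 T1) (\<lambda>t. v (xb, t)) \<tau>b ?\<phi>"
        unfolding subtangent_on_def
      proof
        show "C1_near ?\<phi> \<tau>b" by (rule C1_near_real[OF C1_on_quadratic]) auto
        show "\<forall>\<^sub>F t in at \<tau>b within open_times T0 T1. v (xb, \<tau>b) - ?\<phi> \<tau>b \<le> v (xb, t) - ?\<phi> t"
          unfolding eventually_at_topological
        proof (intro exI[of _ "{T0<..<T'}"] conjI ballI impI)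
          fix t assume "t \<in> {T0<..<T'}"
          then show "v (xb, \<tau>b) - ?\<phi> \<tau>b \<le> v (xb, t) - ?\<phi> t"
            using max[of xb tb t] xb tb power2_commute[of t tb] power2_commute[of \<tau>b tb] by simp
        qed (use \<tau>bI in auto)
      qed
      have "(?\<phi> has_real_derivative 2 * (- C) * (\<tau>b - tb) + 2 * 0 * (\<tau>b - tb) + 0) (at \<tau>b)"
        using C1_on_quadratic unfolding C1_on_def by blast
      then have "deriv ?\<phi> \<tau>b = a" by (simp add: DERIV_imp_deriv a_def algebra_simps)
      then show "deriv ?\<phi> \<tau>b < c xb" using a\<delta> \<delta> by linarith
    qed
    then obtain \<gamma> where \<gamma>: "\<gamma> \<in> arcs_to E xb" and sc: "\<And>\<phi>.
          subtangent_on ({0..1} \<times> closure (open_times T0 T1)) (along v \<gamma>) (1, \<tau>b) \<phi> \<Longrightarrow>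
          dt \<phi> 1 \<tau>b + H \<gamma> 1 (ds \<phi> 1 \<tau>b) \<ge> 0"
      using assms(9) xbV tbO unfolding HJ_supersolution_def by blast
    have \<gamma>E: "\<gamma> \<in> E" "\<gamma> 1 = xb" using \<gamma> by (auto simp: arcs_to_def pathfinish_def)
    have "finite (arcs_to E xb)" using assms(3) by (auto simp: arcs_to_def network_def)
    then have "c xb \<le> arc_const (H \<gamma>)"
      using assms(5) xbV \<gamma> unfolding flux_limiter_def
      by (meson Min_le finite_imageI imageI order_trans)
    then have "- arc_const (H \<gamma>) < - \<delta> / 2 - a" using a\<delta> \<delta> by linarith
    \<comment> \<open>Since \<open>a + \<delta> \<le> c xb \<le> arc_const (H \<gamma>)\<close>, the
      minimum of the Hamiltonian at the vertex lies below \<open>- a\<close> by at least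
      \<open>\<delta>\<close>, leaving room for \<open>\<delta> / 2\<close>.\<close>
    then obtain p0 where "H \<gamma> 1 p0 < - \<delta> / 2 - a"
      using arc_const_slope[OF contH[OF \<gamma>E(1)] coerH[OF \<gamma>E(1)], of 1] by auto
    then have p0: "a + H \<gamma> 1 p0 < - \<delta> / 2" by linarith
    have "convex_on UNIV (H \<gamma> 1)" using convH[OF \<gamma>E(1), of 1] by simp
    from vertex_slope[OF sub[OF \<gamma>E(1)] sup[OF \<gamma>E(1)] \<eta>(1) \<theta>(1) C(1) \<delta> contw[OF \<gamma>E(1)]
        contv[OF \<gamma>E(1)] dbl[OF \<gamma>E] contH[OF \<gamma>E(1)] this coerH[OF \<gamma>E(1)] a_def p0]
    obtain \<rho> where \<rho>: "0 < \<rho>" "\<rho> \<le> 1" and below: "\<And>s \<tau>. s \<in> {1 - \<rho>..1} \<Longrightarrow> \<tau> \<in> {\<tau>b - \<rho>..\<tau>b + \<rho>} \<Longrightarrow>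
        along v \<gamma> (1, \<tau>b) + a * (\<tau> - \<tau>b) - 2 * C * (\<tau> - \<tau>b)^2 + p0 * (s - 1) \<le> along v \<gamma> (s, \<tau>)"
      by blast
    \<comment> \<open>The bound \<open>below\<close> says exactly that this separated function, with
      slope \<open>p0\<close> and time derivative \<open>a\<close> at the vertex, is a constrained
      subtangent. The condition on \<open>\<gamma>\<close> then contradicts the choice of
      \<open>p0\<close>.\<close>
    let ?f = "\<lambda>s. 0 * (s - 1)^2 + 0 * (s - 1)^2 + p0 * s"
    let ?g = "\<lambda>t. - 2 * C * (t - \<tau>b)^2 + 0 * (t - \<tau>b)^2 + a * t"
    have f: "C1_on UNIV ?f (\<lambda>s. 2 * 0 * (s - 1) + 2 * 0 * (s - 1) + p0)"
      and g: "C1_on UNIV ?g (\<lambda>t. 2 * (- 2 * C) * (t - \<tau>b) + 2 * 0 * (t - \<tau>b) + a)"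
      by (rule C1_on_quadratic)+
    have "subtangent_on ({0..1} \<times> closure (open_times T0 T1)) (along v \<gamma>) (1, \<tau>b) (\<lambda>(s, t). ?f s + ?g t)"
      unfolding subtangent_on_def
    proof (intro conjI C1_near_sep[OF f g UNIV_I UNIV_I]
        eventually_box[of "{1 - \<rho><..<2}" "{\<tau>b - \<rho><..<\<tau>b + \<rho>}"])
      fix s t assume "s \<in> {1 - \<rho><..<2}" "t \<in> {\<tau>b - \<rho><..<\<tau>b + \<rho>}"
        "(s, t) \<in> {0..1} \<times> closure (open_times T0 T1)"
      then have "along v \<gamma> (1, \<tau>b) + a * (t - \<tau>b) - 2 * C * (t - \<tau>b)^2 + p0 * (s - 1) \<le> along v \<gamma> (s, t)"
        by (intro below) auto
      then show "along v \<gamma> (1, \<tau>b) - (case (1, \<tau>b) of (s, t) \<Rightarrow> ?f s + ?g t)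
          \<le> along v \<gamma> (s, t) - (case (s, t) of (s, t) \<Rightarrow> ?f s + ?g t)"
        by (simp add: algebra_simps)
    qed (use \<rho> in auto)
    from sc[OF this] have "0 \<le> a + H \<gamma> 1 p0"
      unfolding ds_sep[OF f UNIV_I] dt_sep[OF g UNIV_I] by simp
    then show False using p0 \<delta> by linarith
  qed
qed

end
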